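(* Let $\Omega$ and $\Omega'$ be aperiodic repetitive tiling spaces of $\mathbb{R}^d$ with finite local complexity, and let $h:\Omega\to\Omega'$ be a homeomorphism. Then $(\Omega,\mathbb{R}^d)$ is linearly repetitive if and only if $(\Omega',\mathbb{R}^d)$ is linearly repetitive.
   Context: Tilings. A tile is a compact subset of $\mathbb{R}^d$ homeomorphic to a closed ball and equal to the closure of its interior (possibly decorated with a label); a prototile is an equivalence class of tiles under translation. For each tiling space a finite collection of prototiles is fixed. A tiling is a collection $T=\{t_i\}_{i\in I}$ of tiles whose translation classes are in this collection, whose union is $\mathbb{R}^d$, and such that $t_i\cap t_j$ has empty interior for $i\neq j$. For $x\in\mathbb{R}^d$, $T-x=\{t_i-x\}_{i\in I}$ (tilings are not identified with their translates). $B(x,r)$ is the ball of centre $x$ and radius $r$, and $T\cap B(x,r)$ denotes the patch of all tiles of $T$ which intersect $B(x,r)$. $T$ is aperiodic if $T-x\neq T$ for all $x\neq 0$; $T$ has finite local complexity (FLC) if for all $R>0$ there are finitely many patches $T\cap B(x,R)$, $x\in\mathbb{R}^d$, up to translation; $T$ is repetitive if for every finite patch $P\subset T$ there is $R>0$ such that a translate of $P$ appears in $T\cap B(x,R)$ for every $x\in\mathbb{R}^d$. Tiling spaces. Define a distance on tilings with the given prototiles by letting $D(T_1,T_2)$ be the minimum of $1/\sqrt2$ and the infimum of all $\varepsilon>0$ for which there are $x_1,x_2\in\mathbb{R}^d$ with $\|x_i\|\le\varepsilon$ such that $T_1-x_1$ and $T_2-x_2$ agree on $B(0,1/\varepsilon)$.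 The hull (tiling space) of $T$ is the closure $\Omega=\overline{\{T-x : x\in\mathbb{R}^d\}}$ for $D$; $\mathbb{R}^d$ acts continuously on it by translation. An aperiodic repetitive tiling space with FLC is the hull of an aperiodic, repetitive tiling with FLC. Transversals. A Delaunay set is a uniformly discrete and relatively dense subset of $\mathbb{R}^d$. A local pointing rule on $\Omega$ is a map $\mathcal{D}$ assigning to each $T\in\Omega$ a Delaunay set $\mathcal{D}(T)$, commuting with translations ($\mathcal{D}(T-x)=\mathcal{D}(T)-x$), and local: there are $\rho,R>0$ such that for all $T\in\Omega$, $\mathcal{D}(T)\cap B(0,\rho)$ only depends on $T\cap B(0,R)$. The canonical transversal associated with $\mathcal{D}$ is $\Xi_{\mathcal{D}}=\{T\in\Omega : 0\in\mathcal{D}(T)\}$. Repetitivity. For a canonical transversal $\Xi$, the repetitivity function is $$\mathcal{R}_\Xi(r)=\inf\{R>0 : \forall\, T,T_0\in\Xi,\ \exists\, x\in B(0,R),\ (T-x)\cap B(0,r)=T_0\cap B(0,r)\}.$$ $(\Omega,\mathbb{R}^d)$ is linearly repetitive if for some canonical transversal $\Xi$ (equivalently, for all) there is a constant $\lambda$ with $\mathcal{R}_\Xi(r)\le\lambda r$ for all $r$ big enough. *)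

theory Defs
  imports "HOL-Analysis.Analysis"
begin

text \<open>A tile is a support together with a label; for undecorated tiles take the label type to be
  \<^typ>\<open>unit\<close>.\<close>

type_synonym ('a, 'l) tile = "'a set \<times> 'l"

definition is_tile :: "('a::euclidean_space, 'l) tile \<Rightarrow> bool" where
  "is_tile t \<longleftrightarrow> compact (fst t) \<and> fst t homeomorphic cball (0::'a) 1
     \<and> closure (interior (fst t)) = fst t"

text \<open>The translate \<open>t - x\<close>.\<close>

definition shift_tile :: "('a::euclidean_space, 'l) tile \<Rightarrow> 'a \<Rightarrow> ('a, 'l) tile" where
  "shift_tile t x = ((\<lambda>y. y - x) ` fst t, snd t)"

definition prototile :: "('a::euclidean_space, 'l) tile \<Rightarrow> ('a, 'l) tile set" where
  "prototile t = range (shift_tile t)"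

definition prototile_collection :: "('a::euclidean_space, 'l) tile set set \<Rightarrow> bool" where
  "prototile_collection \<P> \<longleftrightarrow> finite \<P> \<and> \<P> \<subseteq> prototile ` {t. is_tile t}"

text \<open>Distinct tiles of a tiling overlap in a set with empty interior, while tiles themselves have
  nonempty interior, so no tile can occur twice in an indexed family and a tiling is just a set.\<close>

definition tiling :: "('a::euclidean_space, 'l) tile set set \<Rightarrow> ('a, 'l) tile set \<Rightarrow> bool" where
  "tiling \<P> T \<longleftrightarrow> (\<forall>t\<in>T. is_tile t \<and> prototile t \<in> \<P>)
     \<and> (\<Union>t\<in>T. fst t) = UNIV
     \<and> (\<forall>s\<in>T. \<forall>t\<in>T. s \<noteq> t \<longrightarrow> interior (fst s \<inter> fst t) = {})"

text \<open>\<open>T - x\<close>, for a tiling or a patch.\<close>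

definition shift :: "('a::euclidean_space, 'l) tile set \<Rightarrow> 'a \<Rightarrow> ('a, 'l) tile set" where
  "shift T x = (\<lambda>t. shift_tile t x) ` T"

text \<open>The patch \<open>T \<inter> B(x,r)\<close>: whole tiles meeting the ball, not an intersection of point sets.
  Balls are taken to be closed.\<close>

definition patch :: "('a::euclidean_space, 'l) tile set \<Rightarrow> 'a \<Rightarrow> real \<Rightarrow> ('a, 'l) tile set" where
  "patch T x r = {t \<in> T. fst t \<inter> cball x r \<noteq> {}}"

definition aperiodic :: "('a::euclidean_space, 'l) tile set \<Rightarrow> bool" where
  "aperiodic T \<longleftrightarrow> (\<forall>x. x \<noteq> 0 \<longrightarrow> shift T x \<noteq> T)"

text \<open>\<open>range (shift P)\<close> is the translation class of the patch \<open>P\<close>.\<close>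

definition finite_local_complexity :: "('a::euclidean_space, 'l) tile set \<Rightarrow> bool" where
  "finite_local_complexity T \<longleftrightarrow> (\<forall>R>0. finite {range (shift (patch T x R)) | x. True})"

definition repetitive :: "('a::euclidean_space, 'l) tile set \<Rightarrow> bool" where
  "repetitive T \<longleftrightarrow>
     (\<forall>P. finite P \<and> P \<subseteq> T \<longrightarrow> (\<exists>R>0. \<forall>x. \<exists>v. shift P v \<subseteq> patch T x R))"

text \<open>The cut-off \<open>1/\<surd>2\<close> is inserted into the set, which amounts to taking the minimum with the
  infimum and gives \<open>1/\<surd>2\<close> when no \<open>\<epsilon>\<close> is admissible.\<close>

definition tiling_dist :: "('a::euclidean_space, 'l) tile set \<Rightarrow> ('a, 'l) tile set \<Rightarrow> real" where
  "tiling_dist T1 T2 = Inf (insert (1 / sqrt 2)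
     {\<epsilon>. \<epsilon> > 0 \<and> (\<exists>x1 x2. norm x1 \<le> \<epsilon> \<and> norm x2 \<le> \<epsilon>
        \<and> patch (shift T1 x1) 0 (1 / \<epsilon>) = patch (shift T2 x2) 0 (1 / \<epsilon>))})"

definition tiling_topology :: "('a::euclidean_space, 'l) tile set set \<Rightarrow> ('a, 'l) tile set topology" where
  "tiling_topology \<P> = Metric_space.mtopology {T. tiling \<P> T} tiling_dist"

definition tiling_hull ::
    "('a::euclidean_space, 'l) tile set set \<Rightarrow> ('a, 'l) tile set \<Rightarrow> ('a, 'l) tile set set" where
  "tiling_hull \<P> T = tiling_topology \<P> closure_of (range (shift T))"

definition aperiodic_repetitive_FLC_space ::
    "('a::euclidean_space, 'l) tile set set \<Rightarrow> ('a, 'l) tile set set \<Rightarrow> bool" where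
  "aperiodic_repetitive_FLC_space \<P> \<Omega> \<longleftrightarrow> prototile_collection \<P> \<and>
     (\<exists>T. tiling \<P> T \<and> aperiodic T \<and> repetitive T \<and> finite_local_complexity T \<and> \<Omega> = tiling_hull \<P> T)"

definition relatively_dense :: "'a::euclidean_space set \<Rightarrow> bool" where
  "relatively_dense X \<longleftrightarrow> (\<exists>R>0. \<forall>x. X \<inter> cball x R \<noteq> {})"

definition Delaunay :: "'a::euclidean_space set \<Rightarrow> bool" where
  "Delaunay X \<longleftrightarrow> uniform_discrete X \<and> relatively_dense X"

definition local_pointing_rule ::
    "('a::euclidean_space, 'l) tile set set \<Rightarrow> (('a, 'l) tile set \<Rightarrow> 'a set) \<Rightarrow> bool" where
  "local_pointing_rule \<Omega> \<D> \<longleftrightarrow>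
     (\<forall>T\<in>\<Omega>. Delaunay (\<D> T))
     \<and> (\<forall>T\<in>\<Omega>. \<forall>x. \<D> (shift T x) = (\<lambda>y. y - x) ` \<D> T)
     \<and> (\<exists>\<rho>>0. \<exists>R>0. \<forall>T\<in>\<Omega>. \<forall>T'\<in>\<Omega>. patch T 0 R = patch T' 0 R
          \<longrightarrow> \<D> T \<inter> cball 0 \<rho> = \<D> T' \<inter> cball 0 \<rho>)"

definition canonical_transversal ::
    "('a::euclidean_space, 'l) tile set set \<Rightarrow> (('a, 'l) tile set \<Rightarrow> 'a set) \<Rightarrow> ('a, 'l) tile set set" where
  "canonical_transversal \<Omega> \<D> = {T \<in> \<Omega>. 0 \<in> \<D> T}"

text \<open>Extended reals, so that the infimum of the empty set is \<open>\<infinity>\<close>.\<close>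

definition repetitivity_function :: "('a::euclidean_space, 'l) tile set set \<Rightarrow> real \<Rightarrow> ereal" where
  "repetitivity_function \<Xi> r =
     Inf (ereal ` {R. R > 0 \<and> (\<forall>T\<in>\<Xi>. \<forall>T0\<in>\<Xi>. \<exists>x\<in>cball 0 R. patch (shift T x) 0 r = patch T0 0 r)})"

definition linearly_repetitive :: "('a::euclidean_space, 'l) tile set set \<Rightarrow> bool" where
  "linearly_repetitive \<Omega> \<longleftrightarrow>
     (\<exists>\<D>. local_pointing_rule \<Omega> \<D> \<and>
        (\<exists>C::real. \<forall>\<^sub>F r in at_top.
           repetitivity_function (canonical_transversal \<Omega> \<D>) r \<le> ereal (C * r)))"

text \<open>The topology above is the one of a genuine metric space.\<close>

definition tilings_close :: "('a::euclidean_space, 'l) tile set \<Rightarrow> ('a, 'l) tile set \<Rightarrow> real \<Rightarrow> bool" where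
  "tilings_close T1 T2 \<epsilon> \<longleftrightarrow> \<epsilon> > 0 \<and> (\<exists>x1 x2. norm x1 \<le> \<epsilon> \<and> norm x2 \<le> \<epsilon>
        \<and> patch (shift T1 x1) 0 (1 / \<epsilon>) = patch (shift T2 x2) 0 (1 / \<epsilon>))"

lemma tiling_dist_close: "tiling_dist T1 T2 = Inf (insert (1 / sqrt 2) {\<epsilon>. tilings_close T1 T2 \<epsilon>})"
  by (simp add: tiling_dist_def tilings_close_def)

lemma tilings_close_sym: "tilings_close T1 T2 \<epsilon> \<Longrightarrow> tilings_close T2 T1 \<epsilon>"
  unfolding tilings_close_def by metis

lemma shift_tile_shift_tile: "shift_tile (shift_tile t x) y = shift_tile t (x + y)"
  by (simp add: shift_tile_def image_image diff_diff_eq)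

lemma shift_tile_0 [simp]: "shift_tile t 0 = t"
  by (simp add: shift_tile_def)

lemma shift_shift: "shift (shift T x) y = shift T (x + y)"
  by (simp add: shift_def image_image shift_tile_shift_tile)

lemma patch_shift: "patch (shift T x) y r = shift (patch T (y + x) r) x"
proof -
  have "(\<lambda>z. z - x) ` S \<inter> cball y r = (\<lambda>z. z - x) ` (S \<inter> cball (y + x) r)" for S :: "'a set"
    by (auto simp: dist_norm algebra_simps)
  then have "fst (shift_tile t x) \<inter> cball y r \<noteq> {} \<longleftrightarrow> fst t \<inter> cball (y + x) r \<noteq> {}"
    for t :: "('a, 'b) tile"
    by (simp add: shift_tile_def)
  then show ?thesis
    unfolding patch_def shift_def by blast
qed

lemma shift_patch: "shift (patch T x r) x = patch (shift T x) 0 r"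
  by (simp add: patch_shift)

lemma patch_mono:
  assumes "patch T1 x r = patch T2 x r" "cball y s \<subseteq> cball x r"
  shows "patch T1 y s = patch T2 y s"
  using assms unfolding patch_def by blast

lemma tilings_close_triangle:
  fixes T1 T2 T3 :: "('a::euclidean_space, 'l) tile set"
  assumes "tilings_close T1 T2 a" "tilings_close T2 T3 b" "a + b \<le> 1"
  shows "tilings_close T1 T3 (a + b)"
proof -
  obtain x1 x2 where x: "a > 0" "norm x1 \<le> a" "norm x2 \<le> a"
    "patch (shift T1 x1) 0 (1/a) = patch (shift T2 x2) 0 (1/a)"
    using assms(1) by (auto simp: tilings_close_def)
  obtain y2 y3 where y: "b > 0" "norm y2 \<le> b" "norm y3 \<le> b"
    "patch (shift T2 y2) 0 (1/b) = patch (shift T3 y3) 0 (1/b)"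
    using assms(2) by (auto simp: tilings_close_def)
  have aux: "1/(a'+b') + b' \<le> 1/a'" if "a' > 0" "b' > 0" "a' + b' \<le> 1" for a' b' :: real
  proof -
    have "1/a' - 1/(a'+b') = b' / (a' * (a'+b'))" using that by (simp add: field_simps)
    moreover have "a' * (a' + b') \<le> 1 * 1" using that by (intro mult_mono) auto
    then have "b' \<le> b' / (a' * (a'+b'))" using that
      by (simp add: pos_le_divide_eq mult_left_le)
    ultimately show ?thesis by linarith
  qed
  have "cball y2 (1/(a+b)) \<subseteq> cball 0 (1/a)"
    using aux[of a b] x y assms(3) by (simp add: cball_subset_cball_iff dist_norm)
  then have "patch (shift T1 x1) y2 (1/(a+b)) = patch (shift T2 x2) y2 (1/(a+b))"
    by (rule patch_mono[OF x(4)])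
  then have "shift (patch (shift T1 x1) y2 (1/(a+b))) y2 = shift (patch (shift T2 x2) y2 (1/(a+b))) y2"
    by (rule arg_cong)
  then have 1: "patch (shift T1 (x1 + y2)) 0 (1/(a+b)) = patch (shift T2 (x2 + y2)) 0 (1/(a+b))"
    by (simp only: shift_patch shift_shift)
  have "cball x2 (1/(a+b)) \<subseteq> cball 0 (1/b)"
    using aux[of b a] x y assms(3) by (simp add: cball_subset_cball_iff dist_norm add.commute)
  then have "patch (shift T2 y2) x2 (1/(a+b)) = patch (shift T3 y3) x2 (1/(a+b))"
    by (rule patch_mono[OF y(4)])
  then have "shift (patch (shift T2 y2) x2 (1/(a+b))) x2 = shift (patch (shift T3 y3) x2 (1/(a+b))) x2"
    by (rule arg_cong)
  then have 2: "patch (shift T2 (x2 + y2)) 0 (1/(a+b)) = patch (shift T3 (y3 + x2)) 0 (1/(a+b))"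
    by (simp only: shift_patch shift_shift add.commute[of y2 x2])
  have "norm (x1 + y2) \<le> a + b" "norm (y3 + x2) \<le> a + b"
    using x y norm_triangle_ineq[of x1 y2] norm_triangle_ineq[of y3 x2] by linarith+
  with 1 2 x(1) y(1) show ?thesis unfolding tilings_close_def
    by (metis add_pos_pos)
qed

lemma bdd_below_close: "bdd_below (insert (1 / sqrt 2) {\<epsilon>. tilings_close T1 T2 \<epsilon>})"
  by (rule bdd_belowI[of _ 0]) (auto simp: tilings_close_def)

lemma tiling_dist_le: "tilings_close T1 T2 \<epsilon> \<Longrightarrow> tiling_dist T1 T2 \<le> \<epsilon>"
  unfolding tiling_dist_close by (intro cInf_lower bdd_below_close) auto

lemma tiling_dist_le_cutoff: "tiling_dist T1 T2 \<le> 1 / sqrt 2"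
  unfolding tiling_dist_close by (intro cInf_lower bdd_below_close) auto

lemma tiling_dist_lessE:
  assumes "tiling_dist T1 T2 < \<epsilon>" "\<epsilon> \<le> 1 / sqrt 2"
  obtains \<delta> where "tilings_close T1 T2 \<delta>" "\<delta> < \<epsilon>"
  using assms cInf_lessD[of "insert (1 / sqrt 2) {\<epsilon>. tilings_close T1 T2 \<epsilon>}" \<epsilon>]
  unfolding tiling_dist_close by auto

lemma tiling_dist_nonneg: "0 \<le> tiling_dist T1 T2"
  unfolding tiling_dist_close by (rule cInf_greatest) (auto simp: tilings_close_def)

lemma tiling_dist_commute: "tiling_dist T1 T2 = tiling_dist T2 T1"
  proof -
  have "{\<epsilon>. tilings_close T1 T2 \<epsilon>} = {\<epsilon>. tilings_close T2 T1 \<epsilon>}" using tilings_close_sym by blast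
  then show ?thesis by (simp only: tiling_dist_close)
qed

lemma tiling_dist_triangle: "tiling_dist T1 T3 \<le> tiling_dist T1 T2 + tiling_dist T2 T3"
proof (rule ccontr)
  assume "\<not> ?thesis"
  define e where "e = (tiling_dist T1 T3 - tiling_dist T1 T2 - tiling_dist T2 T3) / 2"
  have e: "e > 0" "tiling_dist T1 T2 + tiling_dist T2 T3 + 2 * e = tiling_dist T1 T3"
    using \<open>\<not> _\<close> by (simp_all add: e_def field_simps)
  have c: "1 / sqrt 2 \<le> (1::real)" by simp
  have bds: "tiling_dist T1 T3 \<le> 1 / sqrt 2" "0 \<le> tiling_dist T1 T2" "0 \<le> tiling_dist T2 T3"
    by (simp_all only: tiling_dist_le_cutoff tiling_dist_nonneg)
  obtain a where a: "tilings_close T1 T2 a" "a < tiling_dist T1 T2 + e"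
  proof (rule tiling_dist_lessE[of T1 T2 "tiling_dist T1 T2 + e"])
    show "tiling_dist T1 T2 < tiling_dist T1 T2 + e" using e by simp
    show "tiling_dist T1 T2 + e \<le> 1 / sqrt 2" using e bds by linarith
  qed
  obtain b where b: "tilings_close T2 T3 b" "b < tiling_dist T2 T3 + e"
  proof (rule tiling_dist_lessE[of T2 T3 "tiling_dist T2 T3 + e"])
    show "tiling_dist T2 T3 < tiling_dist T2 T3 + e" using e by simp
    show "tiling_dist T2 T3 + e \<le> 1 / sqrt 2" using e bds by linarith
  qed
  have "a + b \<le> 1" using a b e bds c by linarith
  then have "tiling_dist T1 T3 \<le> a + b"
    using tilings_close_triangle[OF a(1) b(1)] tiling_dist_le by blast
  then show False using a b e by linarith
qed

lemma tiling_dist_self: "tiling_dist T T = 0"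
proof (rule ccontr)
  assume "\<not> ?thesis"
  then have "tiling_dist T T > 0" using tiling_dist_nonneg[of T T] by linarith
  moreover have "tilings_close T T (tiling_dist T T / 2)"
    using calculation by (auto simp: tilings_close_def intro!: exI[of _ 0])
  ultimately show False using tiling_dist_le[of T T "tiling_dist T T / 2"] by linarith
qed

lemma compact_translation_invariant:
  fixes S :: "'a::euclidean_space set"
  assumes "compact S" "S \<noteq> {}" "(\<lambda>y. y - v) ` S = (\<lambda>y. y - w) ` S"
  shows "v = w"
proof -
  define u where "u = w - v"
  obtain y where y: "y \<in> S" "\<And>z. z \<in> S \<Longrightarrow> z \<bullet> u \<le> y \<bullet> u"
    using continuous_attains_sup[OF assms(1,2), of "\<lambda>z. z \<bullet> u",
        OF continuous_on_inner[OF continuous_on_id continuous_on_const]]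
    by blast
  have "y - v \<in> (\<lambda>y. y - w) ` S" using assms(3) y(1) by blast
  then have "y + u \<in> S" by (auto simp: u_def algebra_simps)
  then have "u \<bullet> u \<le> 0" using y(2) by (fastforce simp: inner_add_left)
  then have "u = 0" by (metis inner_ge_zero inner_eq_zero_iff order_antisym)
  then show ?thesis by (simp add: u_def)
qed

lemma tiling_dist_zero_subset:
  assumes T1: "tiling \<P> T1" and T2: "tiling \<P> T2" and D: "tiling_dist T1 T2 = 0"
  shows "T1 \<subseteq> T2"
proof
  fix t assume t: "t \<in> T1"
  then have tile: "is_tile t" using T1 by (simp add: tiling_def)
  then have "fst t \<noteq> {}" by (auto simp: is_tile_def homeomorphic_empty)
  then have "interior (fst t) \<noteq> {}" using tile by (metis closure_empty is_tile_def)
  then obtain c where c: "c \<in> interior (fst t)" by blast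
  then obtain r where r: "r > 0" "ball c r \<subseteq> fst t"
    by (metis mem_interior)
  have ex: "\<exists>v. norm v < e \<and> shift_tile t v \<in> T2" if "e > 0" for e
  proof -
    define e' where "e' = min (e/2) (min (1 / sqrt 2) (1 / (norm c + 1)))"
    have "norm c + 1 > 0" by (simp add: add_nonneg_pos)
    then have e': "e' > 0" "e' \<le> e/2" "e' \<le> 1 / sqrt 2" "e' \<le> 1 / (norm c + 1)"
      using that by (auto simp: e'_def)
    obtain d where d: "tilings_close T1 T2 d" "d < e'"
      using tiling_dist_lessE[of T1 T2 e'] D e' by auto
    then obtain x1 x2 where x: "d > 0" "norm x1 \<le> d" "norm x2 \<le> d"
      "patch (shift T1 x1) 0 (1/d) = patch (shift T2 x2) 0 (1/d)"
      by (auto simp: tilings_close_def)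
    have "d \<le> 1 / (norm c + 1)" using d e' by linarith
    then have "norm c + 1 \<le> 1/d" using x(1) \<open>norm c + 1 > 0\<close>
      by (simp add: field_simps)
    moreover have "(1::real) / sqrt 2 \<le> 1" by simp
    then have "d \<le> 1" using d e' by linarith
    ultimately have "norm (c - x1) \<le> 1/d"
      using norm_triangle_ineq4[of c x1] x by linarith
    moreover have "c - x1 \<in> fst (shift_tile t x1)"
      using c interior_subset by (auto simp: shift_tile_def)
    ultimately have "shift_tile t x1 \<in> patch (shift T1 x1) 0 (1/d)"
      using t by (auto simp: patch_def shift_def)
    then have "shift_tile t x1 \<in> shift T2 x2" using x(4) unfolding patch_def by blast
    then obtain s where s: "s \<in> T2" "shift_tile t x1 = shift_tile s x2"
      by (auto simp: shift_def)
    then have "shift_tile t (x1 - x2) = s"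
      by (metis add.right_inverse add_uminus_conv_diff shift_tile_0 shift_tile_shift_tile)
    moreover have "norm (x1 - x2) < e"
      using norm_triangle_ineq4[of x1 x2] x d e' by linarith
    ultimately show ?thesis using s by blast
  qed
  obtain v where v: "norm v < r/2" "shift_tile t v \<in> T2" using ex[of "r/2"] r by auto
  show "t \<in> T2"
  proof (cases "v = 0")
    case True then show ?thesis using v by simp
  next
    case False
    then obtain w where w: "norm w < min (norm v) (r/2)" "shift_tile t w \<in> T2"
      using ex[of "min (norm v) (r/2)"] r by auto
    let ?U = "ball (c - v) r \<inter> ball (c - w) r"
    have sub: "ball (c - u) r \<subseteq> fst (shift_tile t u)" for u
    proof
      fix z assume "z \<in> ball (c - u) r"
      then have "z + u \<in> ball c r" by (simp add: dist_norm algebra_simps)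
      then have "z + u \<in> fst t" using r by blast
      then show "z \<in> fst (shift_tile t u)"
        unfolding shift_tile_def by (simp add: image_iff) (metis add_diff_cancel)
    qed
    have "?U \<subseteq> interior (fst (shift_tile t v) \<inter> fst (shift_tile t w))"
      using sub by (intro interior_maximal) (auto intro: open_Int)
    moreover have "c - v \<in> ?U" 
    proof -
      have "norm (v - w) < r" using norm_triangle_ineq4[of v w] v w by linarith
      then show ?thesis using r by (simp add: dist_norm algebra_simps norm_minus_commute)
    qed
    ultimately have "interior (fst (shift_tile t v) \<inter> fst (shift_tile t w)) \<noteq> {}" by blast
    then have "shift_tile t v = shift_tile t w"
      using T2 v(2) w(2) unfolding tiling_def by blast
    then have "(\<lambda>y. y - v) ` fst t = (\<lambda>y. y - w) ` fst t" by (simp add: shift_tile_def)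
    then have "v = w"
      using compact_translation_invariant[of "fst t" v w] tile \<open>fst t \<noteq> {}\<close>
      by (simp add: is_tile_def)
    then show ?thesis using w by simp
  qed
qed

lemma Metric_space_tiling: "Metric_space {T. tiling \<P> T} tiling_dist"
proof
  fix T1 T2 T3 :: "('a, 'b) tile set"
  show "0 \<le> tiling_dist T1 T2" by (rule tiling_dist_nonneg)
  show "tiling_dist T1 T2 = tiling_dist T2 T1" by (rule tiling_dist_commute)
  show "tiling_dist T1 T3 \<le> tiling_dist T1 T2 + tiling_dist T2 T3" by (rule tiling_dist_triangle)
  assume "T1 \<in> {T. tiling \<P> T}" "T2 \<in> {T. tiling \<P> T}"
  then show "tiling_dist T1 T2 = 0 \<longleftrightarrow> T1 = T2"
    using tiling_dist_zero_subset[of \<P> T1 T2] tiling_dist_zero_subset[of \<P> T2 T1]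
      tiling_dist_commute[of T1 T2] tiling_dist_self[of T1] by auto
qed

end

theory Submission
  imports Defs
begin

text \<open>A homeomorphism between tiling spaces need not commute with translations, but it distorts them
  by a bounded amount only, and this is enough to carry linear repetitivity across.

  Rigidity (\<open>ex_rigid_below\<close>): the tiles come from finitely many prototiles, so they all contain a
  ball of some common radius, and two nearby translates of one tiling that share a tile must coincide.
  Compactness (\<open>hull_compactin\<close>): finite local complexity makes the hull compact, so the
  homeomorphism \<open>h\<close> and its inverse are uniformly continuous, which says that the patch of \<open>T\<close>
  around the origin determines the patch of \<open>h T\<close> around the origin up to a small translation.

  Rigidity and uniform continuity together show that \<open>h\<close> maps orbits to orbits, with
  \<open>h (T - u) = h T - p\<close> for a vector \<open>p\<close> whose length is bounded by an affine function of that of \<open>u\<close>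
  (\<open>small_displacement\<close>, \<open>displacement_bound\<close>). Applied along segments to the inverse as well, they
  show that a patch of \<open>T\<close> of radius linear in \<open>r\<close> determines the patch of \<open>h T\<close> of radius \<open>r\<close>, up
  to one translation of length at most \<open>1\<close> (\<open>patches_determine_patches\<close>). The target is aperiodic
  throughout (\<open>hull_aperiodic\<close>), so displacements there are unique, and walking along a segment in
  the source reaches every prescribed point of the target.

  Finally, linear repetitivity is reformulated without transversals (\<open>linearly_recurrent\<close>): all pairs
  of tilings of the space are compared, at the cost of bounded translations. In this form it passes
  from the source to the target by looking for the preimage of a patch (\<open>linearly_recurrent_transfer\<close>),
  and the statement is symmetric in the two spaces.\<close>

section \<open>Patches and translations\<close>

lemma mem_shift_tile: "z \<in> fst (shift_tile t x) \<longleftrightarrow> z + x \<in> fst t"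
  by (force simp: shift_tile_def image_iff algebra_simps)

lemma interior_shift_tile:
  "z \<in> interior (fst (shift_tile t x)) \<longleftrightarrow> z + x \<in> interior (fst t)"
  unfolding shift_tile_def fst_conv interior_translation_subtract
  by (force simp: image_iff algebra_simps)

lemma mem_shift: "t \<in> shift T x \<longleftrightarrow> shift_tile t (-x) \<in> T"
proof
  assume "shift_tile t (-x) \<in> T"
  then have "shift_tile (shift_tile t (-x)) x \<in> shift T x"
    unfolding shift_def by blast
  then show "t \<in> shift T x" by (simp add: shift_tile_shift_tile)
qed (auto simp: shift_def shift_tile_shift_tile)

lemma shift_0 [simp]: "shift T 0 = T"
  by (simp add: shift_def)

lemma shift_inject [simp]: "shift S x = shift T x \<longleftrightarrow> S = T"
  by (metis shift_shift shift_0 add.right_inverse)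

lemma prototile_shift: "prototile (shift_tile t x) = prototile t"
proof -
  have "shift_tile t y \<in> range (\<lambda>y. shift_tile t (x + y))" for y
    by (rule range_eqI[of _ _ "y - x"]) simp
  then show ?thesis
    unfolding prototile_def by (auto simp: shift_tile_shift_tile)
qed

lemma is_tile_shift: "is_tile (shift_tile t x)" if "is_tile t"
proof -
  have "(\<lambda>y. y - x) ` fst t homeomorphic fst t"
    using homeomorphic_translation[of "fst t" "-x"] homeomorphic_sym
    unfolding add.commute[of "-x"] add_uminus_conv_diff by blast
  then have "(\<lambda>y. y - x) ` fst t homeomorphic cball (0::'a) 1"
    using that homeomorphic_trans unfolding is_tile_def by blast
  moreover have "compact ((\<lambda>y. y - x) ` fst t)"
    using that unfolding is_tile_def by (simp add: compact_translation_subtract)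
  ultimately show ?thesis
    using that by (simp add: is_tile_def shift_tile_def interior_translation_subtract
        closure_translation_subtract)
qed

lemma tiling_covers: "tiling \<P> T \<Longrightarrow> \<exists>t\<in>T. z \<in> fst t"
  unfolding tiling_def by (metis UNIV_I UN_E)

lemma tiling_shift: "tiling \<P> (shift T x)" if T: "tiling \<P> T"
  unfolding tiling_def
proof (intro conjI ballI impI)
  fix t assume "t \<in> shift T x"
  then obtain s where "s \<in> T" "t = shift_tile s x" by (auto simp: shift_def)
  then show "is_tile t" "prototile t \<in> \<P>"
    using that by (auto simp: tiling_def is_tile_shift prototile_shift)
next
  have "\<exists>t\<in>shift T x. z \<in> fst t" for z
  proof -
    obtain t where "t \<in> T" "z + x \<in> fst t" using tiling_covers[OF T, of "z + x"] by blast
    then show ?thesis by (auto simp: shift_def mem_shift_tile)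
  qed
  then show "(\<Union>t\<in>shift T x. fst t) = UNIV" by auto
next
  fix s t assume st: "s \<in> shift T x" "t \<in> shift T x" "s \<noteq> t"
  then obtain s' t' where s': "s' \<in> T" "s = shift_tile s' x" and t': "t' \<in> T" "t = shift_tile t' x"
    by (auto simp: shift_def)
  then have "interior (fst s') \<inter> interior (fst t') = {}"
    using T st unfolding tiling_def interior_Int by metis
  then show "interior (fst s \<inter> fst t) = {}"
    unfolding s' t' by (auto simp: interior_shift_tile)
qed

lemma patch_shift_eq_iff:
  "patch (shift S x) y r = patch (shift T x) y r \<longleftrightarrow> patch S (y + x) r = patch T (y + x) r"
  by (simp add: patch_shift)

lemma mem_patch_0: "t \<in> patch T z 0 \<longleftrightarrow> t \<in> T \<and> z \<in> fst t"
  by (simp add: patch_def)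

text \<open>Equality of patches is a local condition: it can be checked one point at a time, a patch of radius
  \<open>0\<close> being the set of tiles through a point. Agreement on a union of balls therefore reduces to
  agreement on each of them.\<close>

lemma patch_eqI:
  assumes "\<And>z. z \<in> cball c r \<Longrightarrow> patch S z 0 = patch T z 0"
  shows "patch S c r = patch T c r"
proof -
  have "(t \<in> S \<and> fst t \<inter> cball c r \<noteq> {}) = (t \<in> T \<and> fst t \<inter> cball c r \<noteq> {})" for t
  proof (cases "fst t \<inter> cball c r = {}")
    case False
    then obtain z where "z \<in> fst t" "z \<in> cball c r" by blast
    then have "t \<in> S \<longleftrightarrow> t \<in> T" using assms[of z] mem_patch_0[of t] by blast
    then show ?thesis by blast
  qed simp
  then show ?thesis unfolding patch_def by blast
qed

lemma patch_eq_UNIV: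
  assumes "tiling \<P> S" "tiling \<P> T" "\<And>z. patch S z 0 = patch T z 0"
  shows "S = T"
proof -
  have ne: "fst t \<noteq> {}" if "t \<in> S \<union> T" for t
    using that assms by (auto simp: tiling_def is_tile_def homeomorphic_empty)
  have iff: "t \<in> S \<longleftrightarrow> t \<in> T" if "z \<in> fst t" for t z
    using assms(3)[of z] that mem_patch_0[of t] by blast
  have "t \<in> S \<longleftrightarrow> t \<in> T" for t
  proof (cases "fst t = {}")
    case False
    then show ?thesis using iff by blast
  qed (use ne in blast)
  then show ?thesis by blast
qed

lemma patch_eq_of_all_radii:
  fixes S T :: "('a::euclidean_space, 'l) tile set"
  assumes "tiling \<P> S" "tiling \<P> T" "\<And>n::nat. \<exists>r\<ge>real n. patch S 0 r = patch T 0 r"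
  shows "S = T"
proof (rule patch_eq_UNIV[OF assms(1,2)])
  fix z :: 'a
  obtain n :: nat where n: "norm z \<le> n" using real_arch_simple by blast
  obtain r where r: "r \<ge> real n" "patch S 0 r = patch T 0 r" using assms(3) by blast
  show "patch S z 0 = patch T z 0"
    by (rule patch_mono[OF r(2)]) (use n r in auto)
qed

lemma patch_eq_shrink: "patch S 0 K = patch T 0 K" if "patch S 0 L = patch T 0 L" "K \<le> L"
  by (rule patch_mono[OF that(1)]) (use that in \<open>simp add: cball_subset_cball_iff\<close>)

lemma patch_eq_shift:
  assumes "patch S 0 L = patch T 0 L" "K + norm x \<le> L"
  shows "patch (shift S x) 0 K = patch (shift T x) 0 K"
proof -
  have "patch S x K = patch T x K"
    by (rule patch_mono[OF assms(1)]) (use assms in \<open>simp add: cball_subset_cball_iff\<close>)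
  then show ?thesis by (simp add: patch_shift_eq_iff)
qed

section \<open>Geometry of tiles\<close>

text \<open>A tile is the closure of its interior, so a point of \<open>t\<close> inside the interior of \<open>s\<close> is
  approached by interior points of \<open>t\<close>, and the two interiors meet.\<close>

lemma tile_eq_of_overlap:
  assumes T: "tiling \<P> T" "s \<in> T" "t \<in> T" and c: "c \<in> interior (fst s)" "c \<in> fst t"
  shows "s = t"
proof (rule ccontr)
  assume "s \<noteq> t"
  then have e: "interior (fst s) \<inter> interior (fst t) = {}" using T by (auto simp: tiling_def)
  have "c \<in> closure (interior (fst t))" using T c by (auto simp: tiling_def is_tile_def)
  then show False
    using e c(1) open_Int_closure_eq_empty[of "interior (fst s)" "interior (fst t)"] by auto
qed

text \<open>Translation changes neither the inradius nor the diameter of a tile, so finitely many prototiles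
  have a common lower bound \<open>\<rho>\<close> for the first and a common upper bound \<open>d\<close> for the second.\<close>

lemma bounded_geometry:
  assumes "prototile_collection (\<P> :: ('a::euclidean_space, 'l) tile set set)"
  obtains \<rho> d where "\<rho> > 0" "d > 0"
    "\<And>T t. tiling \<P> T \<Longrightarrow> t \<in> T \<Longrightarrow> \<exists>c. ball c \<rho> \<subseteq> fst t"
    "\<And>T t y z. tiling \<P> T \<Longrightarrow> t \<in> T \<Longrightarrow> y \<in> fst t \<Longrightarrow> z \<in> fst t \<Longrightarrow> dist y z \<le> d"
proof -
  have "\<exists>r>0. \<exists>d>0. \<forall>t\<in>p. (\<exists>c. ball c r \<subseteq> fst t) \<and> (\<forall>y\<in>fst t. \<forall>z\<in>fst t. dist y z \<le> d)"
    if "p \<in> \<P>" for p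
  proof -
    obtain s where s: "is_tile s" "p = prototile s"
      using assms \<open>p \<in> \<P>\<close> by (auto simp: prototile_collection_def)
    have "interior (fst s) \<noteq> {}"
      using s(1) by (auto simp: is_tile_def homeomorphic_empty)
    then obtain c r where r: "r > 0" "ball c r \<subseteq> fst s" by (metis ex_in_conv mem_interior)
    have "bounded (fst s)" using s compact_imp_bounded is_tile_def by blast
    then obtain d where d: "\<And>y z. y \<in> fst s \<Longrightarrow> z \<in> fst s \<Longrightarrow> dist y z \<le> d"
      unfolding bounded_two_points by blast
    have "(\<exists>c. ball c r \<subseteq> fst t) \<and> (\<forall>y\<in>fst t. \<forall>z\<in>fst t. dist y z \<le> max d 1)" if t: "t \<in> p" for t
    proof -
      obtain x where t: "t = shift_tile s x" using t unfolding s(2) prototile_def by blast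
      have "ball (c - x) r \<subseteq> fst t"
      proof
        fix z assume "z \<in> ball (c - x) r"
        then have "z + x \<in> ball c r" by (simp add: dist_norm algebra_simps)
        then show "z \<in> fst t" using r t by (auto simp: mem_shift_tile)
      qed
      moreover have "dist y z \<le> max d 1" if "y \<in> fst t" "z \<in> fst t" for y z
        using d[of "y + x" "z + x"] that by (simp add: t mem_shift_tile dist_norm)
      ultimately show ?thesis by blast
    qed
    moreover have "max d 1 > 0" by simp
    ultimately show ?thesis using r(1) by blast
  qed
  then obtain r d where rd: "\<And>p. p \<in> \<P> \<Longrightarrow> r p > 0 \<and> d p > 0 \<and>
      (\<forall>t\<in>p. (\<exists>c. ball c (r p) \<subseteq> fst t) \<and> (\<forall>y\<in>fst t. \<forall>z\<in>fst t. dist y z \<le> d p))"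
    by metis
  have fin: "finite \<P>" using assms by (simp add: prototile_collection_def)
  \<comment> \<open>Inserting \<open>1\<close> keeps the extrema defined and positive when \<open>\<P>\<close> is empty.\<close>
  define \<rho> where "\<rho> = Min (insert 1 (r ` \<P>))"
  define D where "D = Max (insert 1 (d ` \<P>))"
  have "\<rho> > 0" using fin rd by (auto simp: \<rho>_def)
  have "D > 0" using fin Max_ge[of "insert 1 (d ` \<P>)" 1] unfolding D_def
    by (smt (verit) finite_imageI finite_insert insertI1)
  have le: "\<rho> \<le> r p" "d p \<le> D" if "p \<in> \<P>" for p
    using fin that by (auto simp: \<rho>_def D_def intro!: Min_le Max_ge)
  have mem: "prototile t \<in> \<P> \<and> t \<in> prototile t" if "tiling \<P> T" "t \<in> T" for T t
    using that unfolding tiling_def prototile_def by (metis rangeI shift_tile_0)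
  show ?thesis
  proof (rule that[OF \<open>\<rho> > 0\<close> \<open>D > 0\<close>])
    fix T t assume "tiling \<P> T" "t \<in> T"
    then obtain c where "ball c (r (prototile t)) \<subseteq> fst t" using rd mem by blast
    then show "\<exists>c. ball c \<rho> \<subseteq> fst t"
      using le(1)[of "prototile t"] mem[OF \<open>tiling \<P> T\<close> \<open>t \<in> T\<close>] by (meson subset_ball subset_trans)
  next
    fix T t y z assume "tiling \<P> T" "t \<in> T" "y \<in> fst t" "z \<in> fst t"
    then have "dist y z \<le> d (prototile t)" using rd mem by blast
    also have "\<dots> \<le> D" using le(2) mem \<open>tiling \<P> T\<close> \<open>t \<in> T\<close> by blast
    finally show "dist y z \<le> D" .
  qed
qed

text \<open>Rigidity: translates of one tiling by vectors at distance less than \<open>\<rho>\<close> that share their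
  tiles at a single point are equal, with equal translation vectors. This turns a displacement known
  up to a small error into one known exactly.\<close>

definition rigid_below where
  "rigid_below \<rho> \<P> \<longleftrightarrow> \<rho> > 0 \<and> (\<forall>S p q z. tiling \<P> S \<longrightarrow>
     patch (shift S p) z 0 = patch (shift S q) z 0 \<longrightarrow> norm (p - q) < \<rho> \<longrightarrow> p = q)"

lemma rigid_belowD:
  assumes "rigid_below \<rho> \<P>" "tiling \<P> S" "patch (shift S p) z 0 = patch (shift S q) z 0"
    "norm (p - q) < \<rho>"
  shows "p = q"
  using assms unfolding rigid_below_def by blast

text \<open>A tile \<open>t\<close> common to \<open>S - p\<close> and \<open>S - q\<close> gives the two tiles \<open>t + p\<close> and \<open>t + q\<close> of \<open>S\<close>.
  If \<open>p - q\<close> is shorter than the inradius they overlap, hence coincide, and a compact set has no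
  nonzero period.\<close>

lemma ex_rigid_below:
  assumes "prototile_collection \<P>"
  obtains \<rho> where "rigid_below \<rho> \<P>"
proof -
  obtain \<rho> where \<rho>: "\<rho> > 0" "\<And>T t. tiling \<P> T \<Longrightarrow> t \<in> T \<Longrightarrow> \<exists>c. ball c \<rho> \<subseteq> fst t"
    using bounded_geometry[OF assms] by metis
  have "p = q" if S: "tiling \<P> S" and eq: "patch (shift S p) z 0 = patch (shift S q) z 0"
    and less: "norm (p - q) < \<rho>" for S p q z
  proof -
    obtain t where t: "t \<in> shift S p" "z \<in> fst t"
      using tiling_covers[OF tiling_shift[OF S]] by blast
    then have "t \<in> patch (shift S p) z 0" by (auto simp: patch_def)
    then have "t \<in> shift S q" unfolding eq by (auto simp: patch_def)
    with t have mem: "shift_tile t (-p) \<in> S" "shift_tile t (-q) \<in> S" by (auto simp: mem_shift)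
    obtain c where c: "ball c \<rho> \<subseteq> fst t" using \<rho> t(1) tiling_shift[OF S] by blast
    have "ball c \<rho> \<subseteq> interior (fst t)" using c by (simp add: interior_maximal)
    moreover have "c \<in> ball c \<rho>" "c + (p - q) \<in> ball c \<rho>"
      using \<rho>(1) less by (simp_all add: dist_norm norm_minus_commute)
    ultimately have "c \<in> interior (fst t)" "c + (p - q) \<in> interior (fst t)" by blast+
    then have "c + p \<in> interior (fst (shift_tile t (-p)))" "c + p \<in> fst (shift_tile t (-q))"
      using interior_subset by (auto simp: interior_shift_tile mem_shift_tile algebra_simps)
    then have "shift_tile t (-p) = shift_tile t (-q)"
      using tile_eq_of_overlap[OF S] mem by blast
    moreover have "compact (fst t)" "fst t \<noteq> {}"
      using t tiling_shift[OF S, of p] by (auto simp: tiling_def is_tile_def)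
    ultimately show "p = q"
      using compact_translation_invariant[of "fst t" "-p" "-q"] by (simp add: shift_tile_def)
  qed
  with \<rho>(1) show ?thesis using that unfolding rigid_below_def by blast
qed

section \<open>The tiling metric and the hull\<close>

text \<open>Agreement on the ball of radius \<open>K\<close> up to a translation of length at most \<open>e\<close>. Moving only one
  of the two tilings, and keeping the two parameters apart, makes this easier to compose than
  \<^const>\<open>tiling_dist\<close>, to which it is equivalent for small distances.\<close>

definition nearby where
  "nearby e K S T \<longleftrightarrow> (\<exists>p. norm p \<le> e \<and> patch S 0 K = patch (shift T p) 0 K)"

lemma nearby_mono: "nearby e K S T \<Longrightarrow> e \<le> e' \<Longrightarrow> K' \<le> K \<Longrightarrow> nearby e' K' S T"
  unfolding nearby_def by (meson order_trans patch_eq_shrink)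

lemma nearby_shift_self: "nearby (norm u) K T (shift T u)"
  unfolding nearby_def by (rule exI[of _ "-u"]) (simp add: shift_shift)

lemma tiling_dist_le_if_nearby: "nearby e (1 / e) S T \<Longrightarrow> e > 0 \<Longrightarrow> tiling_dist S T \<le> e"
  unfolding nearby_def tilings_close_def
  by (rule tiling_dist_le) (metis shift_0 norm_zero less_imp_le tilings_close_def)

text \<open>Both tilings may move in the definition of the distance. Undoing the motion of the first one
  costs a factor \<open>2\<close> in the translation and at most \<open>1\<close> in the radius of agreement, which
  explains the choice of \<open>\<epsilon>\<close>.\<close>

lemma nearby_if_tiling_dist_less:
  assumes "e > 0"
  obtains \<epsilon> where "\<epsilon> > 0" "\<And>S T. tiling_dist S T < \<epsilon> \<Longrightarrow> nearby e K S T"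
proof
  define \<epsilon> where "\<epsilon> = min (e/2) (min (1 / sqrt 2) (1 / (\<bar>K\<bar> + 1)))"
  show pos: "\<epsilon> > 0" using assms by (auto simp: \<epsilon>_def)
  fix S T :: "('a::euclidean_space, 'b) tile set" assume "tiling_dist S T < \<epsilon>"
  moreover have le: "\<epsilon> \<le> e/2" "\<epsilon> \<le> 1 / sqrt 2" "\<epsilon> \<le> 1 / (\<bar>K\<bar> + 1)"
    unfolding \<epsilon>_def by auto
  ultimately obtain d where d: "tilings_close S T d" "d < \<epsilon>"
    using tiling_dist_lessE by blast
  then obtain x y where xy: "d > 0" "norm x \<le> d" "norm y \<le> d"
    "patch (shift S x) 0 (1/d) = patch (shift T y) 0 (1/d)"
    by (auto simp: tilings_close_def)
  have "d \<le> 1 / (\<bar>K\<bar> + 1)" using d le by linarith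
  then have "\<bar>K\<bar> + 1 \<le> 1 / d" using xy(1) by (simp add: field_simps)
  moreover have "d \<le> 1" using \<open>d \<le> 1 / (\<bar>K\<bar> + 1)\<close>
    by (rule order_trans) simp
  ultimately have "K + norm (-x) \<le> 1/d" using xy by simp
  then have "patch S 0 K = patch (shift T (y - x)) 0 K"
    using patch_eq_shift[OF xy(4), of K "-x"] by (simp add: shift_shift)
  moreover have "norm (y - x) \<le> e"
    using xy d le norm_triangle_ineq4[of y x] by linarith
  ultimately show "nearby e K S T" unfolding nearby_def by blast
qed

text \<open>Membership in the hull needs no approximate translations: the small displacement allowed by the
  distance can be absorbed into the translate of \<open>T\<close>.\<close>

lemma tiling_hull_iff:
  assumes T: "tiling \<P> T"
  shows "S \<in> tiling_hull \<P> T \<longleftrightarrow> tiling \<P> S \<and> (\<forall>K. \<exists>x. patch S 0 K = patch (shift T x) 0 K)"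
proof -
  interpret Metric_space "{T. tiling \<P> T}" tiling_dist by (rule Metric_space_tiling)
  have hull: "S \<in> tiling_hull \<P> T \<longleftrightarrow>
      tiling \<P> S \<and> (\<forall>r>0. \<exists>x. tiling_dist S (shift T x) < r)"
    unfolding tiling_hull_def tiling_topology_def metric_closure_of
    by (auto simp: tiling_shift[OF T])
  show ?thesis
  proof (intro iffI conjI allI)
    assume S: "S \<in> tiling_hull \<P> T"
    then show "tiling \<P> S" by (simp add: hull)
    fix K
    obtain \<epsilon> where \<epsilon>: "\<epsilon> > 0" "\<And>S T :: ('a,'b) tile set. tiling_dist S T < \<epsilon> \<Longrightarrow> nearby 1 K S T"
      using nearby_if_tiling_dist_less[of 1 K, where 'a='a and 'b='b] by auto
    obtain x where "tiling_dist S (shift T x) < \<epsilon>" using S \<epsilon>(1) hull by blast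
    then have "nearby 1 K S (shift T x)" by (rule \<epsilon>(2))
    then show "\<exists>x. patch S 0 K = patch (shift T x) 0 K"
      unfolding nearby_def by (auto simp: shift_shift)
  next
    assume *: "tiling \<P> S \<and> (\<forall>K. \<exists>x. patch S 0 K = patch (shift T x) 0 K)"
    have "\<exists>x. tiling_dist S (shift T x) < r" if "r > 0" for r
    proof -
      obtain x where "patch S 0 (1 / (r/2)) = patch (shift T x) 0 (1 / (r/2))"
        using * by blast
      then have "nearby (r/2) (1 / (r/2)) S (shift T x)"
        unfolding nearby_def using that by (intro exI[of _ 0]) simp
      then have "tiling_dist S (shift T x) \<le> r/2" using that by (intro tiling_dist_le_if_nearby) auto
      then show ?thesis using that by (intro exI[of _ x]) linarith
    qed
    then show "S \<in> tiling_hull \<P> T" using * hull by blast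
  qed
qed

section \<open>Compactness and uniform continuity\<close>

text \<open>Patches that stabilise on larger and larger balls glue to a tiling. Since a tile is bounded, it
  is decided after finitely many steps whether it belongs to the limit.\<close>

lemma tiling_limit:
  fixes U :: "nat \<Rightarrow> ('a::euclidean_space, 'l) tile set"
  assumes U: "\<And>n. tiling \<P> (U n)"
    and step: "\<And>n. patch (U n) 0 (real n) = patch (U (Suc n)) 0 (real n)"
  obtains V where "tiling \<P> V" "\<And>n. patch V 0 (real n) = patch (U n) 0 (real n)"
proof
  define V where "V = {t. \<exists>n. \<forall>m\<ge>n. t \<in> U m}"
  have stable: "patch (U m) 0 (real n) = patch (U n) 0 (real n)" if "n \<le> m" for m n
    using that
  proof (induction m rule: dec_induct)
    case (step m)
    have "patch (U m) 0 (real n) = patch (U (Suc m)) 0 (real n)"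
      by (rule patch_eq_shrink[OF assms(2)]) (use step in simp)
    with step show ?case by simp
  qed simp
  have mem: "t \<in> V \<longleftrightarrow> t \<in> U n" if "fst t \<inter> cball 0 (real n) \<noteq> {}" for t n
  proof -
    have iff: "t \<in> U m \<longleftrightarrow> t \<in> U n" if "n \<le> m" for m
      using stable[OF that] \<open>fst t \<inter> _ \<noteq> {}\<close> unfolding patch_def by blast
    show ?thesis
    proof
      assume "t \<in> V"
      then obtain k where "\<forall>m\<ge>k. t \<in> U m" unfolding V_def by blast
      then have "t \<in> U (max k n)" by simp
      then show "t \<in> U n" using iff[of "max k n"] by simp
    next
      assume "t \<in> U n"
      then show "t \<in> V" unfolding V_def using iff by blast
    qed
  qed
  show "patch V 0 (real n) = patch (U n) 0 (real n)" for n
    unfolding patch_def using mem by blast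
  show "tiling \<P> V"
    unfolding tiling_def
  proof (intro conjI ballI impI)
    fix t assume "t \<in> V"
    then obtain n where "t \<in> U n" unfolding V_def by blast
    then show "is_tile t" "prototile t \<in> \<P>" using U unfolding tiling_def by blast+
  next
    have "\<exists>t\<in>V. z \<in> fst t" for z
    proof -
      obtain n :: nat where n: "norm z \<le> real n" using real_arch_simple by blast
      obtain t where t: "t \<in> U n" "z \<in> fst t" using tiling_covers[OF U] by blast
      have "z \<in> fst t \<inter> cball 0 (real n)" using n t by simp
      then have "t \<in> V" using mem t(1) by blast
      then show ?thesis using t(2) by blast
    qed
    then show "(\<Union>t\<in>V. fst t) = UNIV" by auto
  next
    fix s t assume st: "s \<in> V" "t \<in> V" "s \<noteq> t"
    then obtain j k where "\<forall>m\<ge>j. s \<in> U m" "\<forall>m\<ge>k. t \<in> U m" unfolding V_def by blast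
    then have "s \<in> U (max j k)" "t \<in> U (max j k)" by auto
    then show "interior (fst s \<inter> fst t) = {}" using U st(3) unfolding tiling_def by metis
  qed
qed

text \<open>Along a fast subsequence of a Cauchy sequence, consecutive tilings agree on large balls after
  translations \<open>w n\<close> with \<open>\<Sum>n. norm (w n) \<le> 1\<close>. Translating by the partial sums \<open>W n\<close> makes the
  agreement exact, so the translated tilings glue to a limit \<open>V\<close>; since \<open>W n\<close> converges, the
  subsequence converges to the translate of \<open>V\<close> by the total displacement.\<close>

lemma tilings_mcomplete: "Metric_space.mcomplete {T. tiling \<P> T} tiling_dist"
proof -
  interpret Metric_space "{T. tiling \<P> T}" tiling_dist by (rule Metric_space_tiling)
  show ?thesis unfolding mcomplete_def
  proof (intro allI impI)
    fix \<sigma> :: "nat \<Rightarrow> ('a, 'b) tile set"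
    assume Cauchy: "MCauchy \<sigma>"
    define e :: "nat \<Rightarrow> real" where "e n = (1/2) ^ Suc n" for n
    have e_pos: "e n > 0" for n by (simp add: e_def)
    \<comment> \<open>The extra unit in the radius makes up for the translation by \<open>W n\<close> below.\<close>
    have "\<exists>N. \<forall>m\<ge>N. \<forall>m'\<ge>N. nearby (e n) (real n + 1) (\<sigma> m) (\<sigma> m')" for n
    proof -
      obtain \<epsilon> where \<epsilon>: "\<epsilon> > 0"
          "\<And>S T :: ('a,'b) tile set. tiling_dist S T < \<epsilon> \<Longrightarrow> nearby (e n) (real n + 1) S T"
        using nearby_if_tiling_dist_less[OF e_pos[of n], of "real n + 1", where 'a='a and 'b='b] by auto
      then show ?thesis using Cauchy unfolding MCauchy_def by meson
    qed
    then obtain N where N: "\<And>n m m'. m \<ge> N n \<Longrightarrow> m' \<ge> N n \<Longrightarrow> nearby (e n) (real n + 1) (\<sigma> m) (\<sigma> m')"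
      by metis
    define r where "r n = n + (\<Sum>k\<le>n. N k)" for n
    have r_mono: "strict_mono r" by (rule strict_mono_Suc_iff[THEN iffD2]) (simp add: r_def)
    have "N n \<le> (\<Sum>k\<le>n. N k)" for n by (rule member_le_sum) auto
    then have "r n \<ge> N n" "r (Suc n) \<ge> N n" for n
      by (auto simp: r_def intro: trans_le_add1 trans_le_add2 le_SucI)
    then have "nearby (e n) (real n + 1) (\<sigma> (r n)) (\<sigma> (r (Suc n)))" for n by (intro N)
    then obtain w where w: "\<And>n. norm (w n) \<le> e n"
        "\<And>n. patch (\<sigma> (r n)) 0 (real n + 1) = patch (shift (\<sigma> (r (Suc n))) (w n)) 0 (real n + 1)"
      unfolding nearby_def by metis
    have e_sums: "e sums 1" using power_half_series unfolding e_def .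
    then have summ: "summable (\<lambda>n. norm (w n))"
      using summable_comparison_test[of "\<lambda>n. norm (w n)" e] w(1) sums_summable by auto
    have summ_w: "summable w" using summ by (rule summable_norm_cancel)
    define W where "W n = (\<Sum>k<n. w k)" for n
    have W_lim: "W \<longlonglongrightarrow> suminf w" unfolding W_def using summ_w by (rule summable_LIMSEQ)
    have W_le: "norm (W n) \<le> 1" for n
    proof -
      have "norm (W n) \<le> (\<Sum>k<n. e k)" unfolding W_def by (rule sum_norm_le) (use w in auto)
      also have "\<dots> \<le> suminf e"
        by (rule sum_le_suminf) (use e_sums sums_summable in \<open>auto simp: e_def\<close>)
      finally show ?thesis using e_sums by (simp add: sums_iff)
    qed
    have tiling_\<sigma>: "tiling \<P> (\<sigma> n)" for n using Cauchy unfolding MCauchy_def by blast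
    define U where "U n = shift (\<sigma> (r n)) (W n)" for n
    have U: "tiling \<P> (U n)" for n unfolding U_def by (intro tiling_shift tiling_\<sigma>)
    have "patch (U n) 0 (real n) = patch (U (Suc n)) 0 (real n)" for n
      using patch_eq_shift[OF w(2)[of n], of "real n" "W n"] W_le[of n]
      by (simp add: U_def shift_shift W_def add.commute)
    then obtain V where V: "tiling \<P> V" "\<And>n. patch V 0 (real n) = patch (U n) 0 (real n)"
      using tiling_limit[of \<P> U, OF U] by blast
    let ?L = "shift V (- suminf w)"
    have "limitin mtopology (\<sigma> \<circ> r) ?L sequentially"
      unfolding limitin_metric
    proof (intro conjI allI impI)
      show "?L \<in> {T. tiling \<P> T}" using tiling_shift[OF V(1)] by simp
      fix \<epsilon> :: real assume "\<epsilon> > 0"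
      then have "\<epsilon>/2 > 0" by simp
      have "\<forall>\<^sub>F n in sequentially. dist (W n) (suminf w) < \<epsilon>/2"
        using W_lim \<open>\<epsilon>/2 > 0\<close> by (rule tendstoD)
      moreover have "\<forall>\<^sub>F n in sequentially. real n \<ge> 1 / (\<epsilon>/2) + 1"
        using filterlim_real_sequentially unfolding filterlim_at_top by blast
      ultimately show "\<forall>\<^sub>F n in sequentially. (\<sigma> \<circ> r) n \<in> {T. tiling \<P> T} \<and>
          tiling_dist ((\<sigma> \<circ> r) n) ?L < \<epsilon>"
      proof eventually_elim
        case (elim n)
        have "patch (shift (U n) (- W n)) 0 (1 / (\<epsilon>/2)) = patch (shift V (- W n)) 0 (1 / (\<epsilon>/2))"
          by (rule patch_eq_shift[OF V(2)[of n, symmetric]]) (use elim W_le[of n] in simp)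
        then have "patch (\<sigma> (r n)) 0 (1 / (\<epsilon>/2)) = patch (shift ?L (suminf w - W n)) 0 (1 / (\<epsilon>/2))"
          by (simp add: U_def shift_shift)
        then have "nearby (\<epsilon>/2) (1 / (\<epsilon>/2)) (\<sigma> (r n)) ?L"
          unfolding nearby_def using elim
          by (intro exI[of _ "suminf w - W n"]) (simp add: dist_norm norm_minus_commute)
        then have "tiling_dist (\<sigma> (r n)) ?L \<le> \<epsilon>/2" using \<open>\<epsilon>/2 > 0\<close> by (rule tiling_dist_le_if_nearby)
        then show ?case using \<open>\<epsilon> > 0\<close> tiling_\<sigma> by (simp add: o_def)
      qed
    qed
    then show "\<exists>x. limitin mtopology \<sigma> x sequentially"
      using MCauchy_convergent_subsequence[OF Cauchy r_mono] by blast
  qed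
qed

text \<open>The patch \<open>P = patch S 0 L\<close> covers the open ball of radius \<open>L\<close>, so a tile of \<open>T \<supseteq> P\<close> that
  meets the ball of radius \<open>K < L\<close> overlaps a tile of \<open>P\<close> and is equal to it. The strict inequality
  excludes tiles that touch the covered region only at its boundary.\<close>

lemma patch_eq_of_patch_subset:
  assumes S: "tiling \<P> S" and T: "tiling \<P> T" and sub: "patch S 0 L \<subseteq> T" and K: "K < L"
  shows "patch S 0 K = patch T 0 K"
proof -
  have "t \<in> S \<longleftrightarrow> t \<in> T" if ne: "fst t \<inter> cball 0 K \<noteq> {}" for t
  proof
    assume "t \<in> S"
    then have "t \<in> patch S 0 L" using ne K by (auto simp: patch_def)
    then show "t \<in> T" using sub by blast
  next
    assume t: "t \<in> T"
    have "fst t \<inter> ball 0 L \<noteq> {}" using ne K by auto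
    moreover have "fst t = closure (interior (fst t))" using T t by (auto simp: tiling_def is_tile_def)
    ultimately have "interior (fst t) \<inter> ball 0 L \<noteq> {}"
      using open_Int_closure_eq_empty[of "ball 0 L" "interior (fst t)"] by (metis Int_commute open_ball)
    then obtain c where c: "c \<in> interior (fst t)" "norm c < L" by auto
    obtain s where s: "s \<in> S" "c \<in> fst s" using tiling_covers[OF S] by blast
    then have "c \<in> fst s \<inter> cball 0 L" using c by simp
    then have "s \<in> patch S 0 L" unfolding patch_def using s(1) by blast
    then have "s \<in> T" using sub by blast
    then have "t = s" using tile_eq_of_overlap[OF T t _ c(1) s(2)] by blast
    then show "t \<in> S" using s by simp
  qed
  then show ?thesis unfolding patch_def by blast
qed

text \<open>Finite local complexity says that, up to translation, finitely many patches of radius \<open>K\<close> occur,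
  say those around the points of \<open>X\<close>. Both the patch of \<open>T - y\<close> and its copy in \<open>T - x\<close>, for the
  corresponding \<open>x \<in> X\<close>, have to cover the origin, which bounds the translation \<open>u\<close> between them by
  \<open>K + d\<close>. A finite \<open>e\<close>-net \<open>V\<close> of the ball of that radius then provides a finite net of the
  orbit.\<close>

lemma orbit_mtotally_bounded:
  fixes T :: "('a::euclidean_space, 'l) tile set"
  assumes P: "prototile_collection \<P>" and T: "tiling \<P> T" and FLC: "finite_local_complexity T"
  shows "Metric_space.mtotally_bounded {T. tiling \<P> T} tiling_dist (range (shift T))"
proof -
  interpret Metric_space "{T. tiling \<P> T}" tiling_dist by (rule Metric_space_tiling)
  obtain d where d: "d > 0"
    "\<And>T t y z. tiling \<P> T \<Longrightarrow> t \<in> T \<Longrightarrow> y \<in> fst t \<Longrightarrow> z \<in> fst t \<Longrightarrow> dist y z \<le> d"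
    using bounded_geometry[OF P] by metis
  show ?thesis unfolding mtotally_bounded_def
  proof (intro allI impI)
    fix \<epsilon> :: real assume "\<epsilon> > 0"
    define e where "e = \<epsilon>/2"
    have e: "e > 0" "e < \<epsilon>" using \<open>\<epsilon> > 0\<close> by (auto simp: e_def)
    \<comment> \<open>One unit more than the radius \<open>1/e\<close> of agreement wanted, since an inclusion of patches
      becomes an equality only on smaller balls.\<close>
    define K where "K = 1/e + 1"
    have "K > 0" using e unfolding K_def by (simp add: add_pos_pos)
    define pclass where "pclass x = range (shift (patch T x K))" for x
    have fin: "finite (range pclass)"
      using FLC \<open>K > 0\<close> unfolding finite_local_complexity_def pclass_def by (simp add: full_SetCompr_eq)
    obtain X where X: "finite X" "range pclass = pclass ` X"
      using finite_subset_image[OF fin, of pclass UNIV] by auto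
    obtain V :: "'a set" where V: "finite V" "cball 0 (K + d) \<subseteq> (\<Union>v\<in>V. ball v e)"
      using compact_cball[of "0::'a" "K + d"] e(1) unfolding compact_eq_totally_bounded by metis
    define C where "C = (\<lambda>(x, v). shift T (x + v)) ` (X \<times> V)"
    have "range (shift T) \<subseteq> (\<Union>S\<in>C. mball S \<epsilon>)"
    proof (rule image_subsetI)
      fix y
      have "pclass y \<in> pclass ` X" unfolding X(2)[symmetric] by (rule rangeI)
      then obtain x where x: "x \<in> X" "pclass y = pclass x" by (rule imageE)
      have "shift (patch T y K) y \<in> pclass x" unfolding x(2)[symmetric] unfolding pclass_def by (rule rangeI)
      then obtain v' where v': "shift (patch T y K) y = shift (patch T x K) v'"
        unfolding pclass_def by (rule rangeE)
      define u where "u = v' - x"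
      have eq: "patch (shift T y) 0 K = shift (patch (shift T x) 0 K) u"
        using v' by (simp add: patch_shift shift_shift u_def)
      obtain t where t: "t \<in> shift T y" "0 \<in> fst t" using tiling_covers[OF tiling_shift[OF T]] by blast
      then have "t \<in> patch (shift T y) 0 K" using \<open>K > 0\<close> by (auto simp: patch_def intro!: exI[of _ 0])
      then obtain s where s: "s \<in> patch (shift T x) 0 K" "t = shift_tile s u"
        unfolding eq by (auto simp: shift_def)
      have "u \<in> fst s" using t(2) s(2) by (simp add: mem_shift_tile)
      show "shift T y \<in> (\<Union>S\<in>C. mball S \<epsilon>)"
      proof -
        obtain z where z: "z \<in> fst s" "norm z \<le> K" using s(1) by (auto simp: patch_def)
        have "s \<in> shift T x" using s(1) by (simp add: patch_def)
        then have "dist u z \<le> d" using d(2)[OF tiling_shift[OF T]] \<open>u \<in> fst s\<close> z(1) by blast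
        then have "norm u \<le> K + d" using z(2) norm_triangle_sub[of u z] by (simp add: dist_norm)
        then have "u \<in> (\<Union>v\<in>V. ball v e)" using V(2) by (simp add: subset_iff)
        then obtain v where v: "v \<in> V" "norm (u - v) \<le> e"
          by (auto simp: dist_norm norm_minus_commute)
        have "patch (shift T y) 0 K \<subseteq> shift T (x + u)"
          unfolding eq shift_shift[symmetric] by (auto simp: shift_def patch_def)
        then have "patch (shift T y) 0 (1/e) = patch (shift T (x + u)) 0 (1/e)"
          by (intro patch_eq_of_patch_subset[where \<P> = \<P> and L = K] tiling_shift T) (simp_all add: K_def)
        then have "nearby e (1/e) (shift T y) (shift T (x + v))"
          unfolding nearby_def using v(2) by (intro exI[of _ "u - v"]) (simp add: shift_shift add.assoc)
        then have "tiling_dist (shift T (x + v)) (shift T y) < \<epsilon>"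
          using tiling_dist_le_if_nearby e tiling_dist_commute by (metis le_less_trans)
        then have "shift T y \<in> mball (shift T (x + v)) \<epsilon>" using tiling_shift[OF T] by simp
        moreover have "shift T (x + v) \<in> C" using x(1) v(1) by (force simp: C_def)
        ultimately show ?thesis by blast
      qed
    qed
    moreover have "finite C" using X V by (simp add: C_def)
    moreover have "C \<subseteq> range (shift T)" by (auto simp: C_def)
    ultimately show "\<exists>C. finite C \<and> C \<subseteq> range (shift T) \<and> range (shift T) \<subseteq> (\<Union>S\<in>C. mball S \<epsilon>)"
      by blast
  qed
qed

lemma hull_compactin:
  assumes "prototile_collection \<P>" "tiling \<P> T" "finite_local_complexity T"
  shows "compactin (tiling_topology \<P>) (tiling_hull \<P> T)"
proof -
  interpret Metric_space "{T. tiling \<P> T}" tiling_dist by (rule Metric_space_tiling)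
  show ?thesis
    using orbit_mtotally_bounded[OF assms] mtotally_bounded_eq_compact_closure_of[OF tilings_mcomplete]
    unfolding tiling_hull_def tiling_topology_def by blast
qed

text \<open>Uniform continuity for the tiling metrics, in terms of \<^const>\<open>nearby\<close>. On the side of the
  hypothesis the two parameters are tied together as in the metric, on the side of the conclusion
  they are free.\<close>

definition uniformly_patchwise where
  "uniformly_patchwise \<Omega> h \<longleftrightarrow>
     (\<forall>e>0. \<forall>K. \<exists>\<delta>>0. \<forall>S\<in>\<Omega>. \<forall>T\<in>\<Omega>. nearby \<delta> (1 / \<delta>) S T \<longrightarrow> nearby e K (h S) (h T))"

lemma continuous_map_uniformly_patchwise:
  fixes \<P> :: "('a::euclidean_space, 'l) tile set set" and \<P>' :: "('b::euclidean_space, 'm) tile set set"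
  assumes \<Omega>: "compactin (tiling_topology \<P>) \<Omega>"
    and h: "continuous_map (subtopology (tiling_topology \<P>) \<Omega>) (subtopology (tiling_topology \<P>') \<Omega>') h"
  shows "uniformly_patchwise \<Omega> h"
proof -
  interpret M: Metric_space "{T. tiling \<P> T}" tiling_dist by (rule Metric_space_tiling)
  interpret M': Metric_space "{T. tiling \<P>' T}" tiling_dist by (rule Metric_space_tiling)
  let ?m = "submetric (metric ({T. tiling \<P> T}, tiling_dist)) \<Omega>"
  let ?m' = "submetric (metric ({T. tiling \<P>' T}, tiling_dist)) \<Omega>'"
  have top: "mtopology_of ?m = subtopology (tiling_topology \<P>) \<Omega>"
    "mtopology_of ?m' = subtopology (tiling_topology \<P>') \<Omega>'"
    by (simp_all add: mtopology_of_submetric tiling_topology_def)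
  have "\<Omega> \<subseteq> {T. tiling \<P> T}"
    using compactin_subset_topspace[OF \<Omega>] unfolding tiling_topology_def by simp
  then have space: "mspace ?m = \<Omega>" by auto
  have "compact_space (mtopology_of ?m)"
    unfolding top using \<Omega> compact_space_subtopology by blast
  moreover have "continuous_map (mtopology_of ?m) (mtopology_of ?m') h"
    unfolding top by (rule h)
  ultimately have "uniformly_continuous_map ?m ?m' h"
    using continuous_imp_uniformly_continuous_map by blast
  then have uc: "\<forall>\<epsilon>>0. \<exists>\<delta>>0. \<forall>T\<in>\<Omega>. \<forall>S\<in>\<Omega>. tiling_dist S T < \<delta> \<longrightarrow> tiling_dist (h S) (h T) < \<epsilon>"
    unfolding uniformly_continuous_map_def space by simp
  show ?thesis unfolding uniformly_patchwise_def
  proof (intro allI impI)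
    fix e K :: real assume "e > 0"
    then obtain \<epsilon> where \<epsilon>: "\<epsilon> > 0"
        "\<And>S T :: ('b,'m) tile set. tiling_dist S T < \<epsilon> \<Longrightarrow> nearby e K S T"
      using nearby_if_tiling_dist_less[of e K, where 'a='b and 'b='m] by auto
    obtain \<delta> where \<delta>: "\<delta> > 0" "\<And>S T. S \<in> \<Omega> \<Longrightarrow> T \<in> \<Omega> \<Longrightarrow> tiling_dist S T < \<delta> \<Longrightarrow>
        tiling_dist (h S) (h T) < \<epsilon>"
      using uc \<epsilon>(1) by meson
    have "nearby e K (h S) (h T)" if "S \<in> \<Omega>" "T \<in> \<Omega>" "nearby (\<delta>/2) (1 / (\<delta>/2)) S T" for S T
    proof -
      have "tiling_dist S T \<le> \<delta>/2"
        using that(3) \<delta>(1) by (intro tiling_dist_le_if_nearby) auto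
      then show ?thesis using \<delta> \<epsilon>(2) that by simp
    qed
    then show "\<exists>\<delta>>0. \<forall>S\<in>\<Omega>. \<forall>T\<in>\<Omega>. nearby \<delta> (1 / \<delta>) S T \<longrightarrow> nearby e K (h S) (h T)"
      using \<delta>(1) by (intro exI[of _ "\<delta>/2"]) auto
  qed
qed

section \<open>Translation invariance and aperiodicity of the hull\<close>

definition tiling_space where
  "tiling_space \<P> \<Omega> \<longleftrightarrow> (\<forall>T\<in>\<Omega>. tiling \<P> T \<and> (\<forall>x. shift T x \<in> \<Omega>))"

lemma tiling_space_hull:
  assumes T: "tiling \<P> T"
  shows "tiling_space \<P> (tiling_hull \<P> T)"
  unfolding tiling_space_def
proof (intro ballI conjI allI)
  fix S x assume S: "S \<in> tiling_hull \<P> T"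
  then show "tiling \<P> S" using tiling_hull_iff[OF T] by blast
  have "\<exists>y. patch (shift S x) 0 K = patch (shift T y) 0 K" for K
  proof -
    obtain y where "patch S 0 (K + norm x) = patch (shift T y) 0 (K + norm x)"
      using S tiling_hull_iff[OF T] by blast
    then have "patch (shift S x) 0 K = patch (shift (shift T y) x) 0 K"
      by (rule patch_eq_shift) simp
    then show ?thesis by (auto simp: shift_shift)
  qed
  then show "shift S x \<in> tiling_hull \<P> T"
    using \<open>tiling \<P> S\<close> tiling_shift tiling_hull_iff[OF T] by blast
qed

text \<open>A period \<open>x\<close> of one tiling \<open>S\<close> of the hull is a period of \<open>T\<close>. Given a tile \<open>t\<close> of \<open>T\<close>, let
  \<open>s\<close> be the tile of \<open>T\<close> at an interior point of \<open>t - x\<close>. By repetitivity a copy of \<open>{t, s}\<close> lies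
  in \<open>S\<close>; there the copies of \<open>t - x\<close> and \<open>s\<close> are overlapping tiles, so \<open>s = t - x\<close>.\<close>

lemma hull_period_subset:
  assumes T: "tiling \<P> T" and rep: "repetitive T"
    and S: "S \<in> tiling_hull \<P> T" and period: "shift S x = S"
  shows "shift T x \<subseteq> T"
proof
  fix t' assume "t' \<in> shift T x"
  then obtain t where t: "t \<in> T" "t' = shift_tile t x" by (auto simp: shift_def)
  have tS: "tiling \<P> S" using S tiling_hull_iff[OF T] by blast
  have tile: "is_tile t" using T t by (simp add: tiling_def)
  then have "interior (fst t) \<noteq> {}" by (auto simp: is_tile_def homeomorphic_empty)
  then obtain c where c: "c \<in> interior (fst t)" by blast
  obtain s where s: "s \<in> T" "c - x \<in> fst s" using tiling_covers[OF T] by blast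
  obtain R where R: "R > 0" "\<And>y. \<exists>v. shift {t, s} v \<subseteq> patch T y R"
    using rep t s unfolding repetitive_def by (metis empty_subsetI finite.emptyI finite.insertI insert_subset)
  obtain y where y: "patch S 0 R = patch (shift T y) 0 R" using S tiling_hull_iff[OF T] by blast
  obtain v where "shift {t, s} v \<subseteq> patch T y R" using R(2) by blast
  then have "shift (shift {t, s} v) y \<subseteq> shift (patch T y R) y" unfolding shift_def by (rule image_mono)
  also have "\<dots> = patch S 0 R" using y by (simp add: patch_shift)
  finally have "shift {t, s} (v + y) \<subseteq> S" by (auto simp: shift_shift patch_def)
  define w where "w = v + y"
  have mem: "shift_tile t w \<in> S" "shift_tile s w \<in> S"
    using \<open>shift {t, s} (v + y) \<subseteq> S\<close> by (auto simp: shift_def w_def)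
  have "shift_tile (shift_tile t w) x \<in> shift S x" using mem unfolding shift_def by blast
  then have "shift_tile t (w + x) \<in> S" unfolding period by (simp add: shift_tile_shift_tile)
  moreover have "c - x - w \<in> interior (fst (shift_tile t (w + x)))" "c - x - w \<in> fst (shift_tile s w)"
    using c s by (auto simp: interior_shift_tile mem_shift_tile algebra_simps)
  ultimately have "shift_tile t (w + x) = shift_tile s w"
    using tile_eq_of_overlap[OF tS] mem(2) by blast
  then have "shift_tile (shift_tile t (w + x)) (-w) = shift_tile (shift_tile s w) (-w)" by simp
  then have "shift_tile t x = s" by (simp add: shift_tile_shift_tile)
  then show "t' \<in> T" using t s by simp
qed

lemma hull_aperiodic:
  assumes T: "tiling \<P> T" "repetitive T" "aperiodic T" and S: "S \<in> tiling_hull \<P> T"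
  shows "aperiodic S"
  unfolding aperiodic_def
proof (intro allI impI notI)
  fix x assume "x \<noteq> 0" and per: "shift S x = S"
  then have "shift S (-x) = S" by (metis shift_shift shift_0 add.right_inverse)
  then have "shift T (-x) \<subseteq> T" by (rule hull_period_subset[OF T(1,2) S])
  then have "shift (shift T (-x)) x \<subseteq> shift T x" unfolding shift_def by (rule image_mono)
  then have "T \<subseteq> shift T x" by (simp add: shift_shift)
  moreover have "shift T x \<subseteq> T" by (rule hull_period_subset[OF T(1,2) S per])
  ultimately show False using T(3) \<open>x \<noteq> 0\<close> unfolding aperiodic_def by blast
qed

lemma aperiodic_shift_inject: "aperiodic T \<Longrightarrow> shift T x = shift T y \<longleftrightarrow> x = y"
  unfolding aperiodic_def
  by (metis shift_shift shift_0 add.right_inverse add_uminus_conv_diff right_minus_eq)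

section \<open>Homeomorphisms move tilings along orbits\<close>

text \<open>A short translation of \<open>T\<close> results in a short translation of \<open>h T\<close>. Along the segment from
  \<open>0\<close> to \<open>u\<close>, all tilings \<open>H s = h (T - s u)\<close> are close to \<open>H 0\<close>, which provides vectors \<open>p s\<close> such
  that \<open>H s - p s\<close> agrees with \<open>H 0\<close> near the origin. In fact they agree on every ball: subdivide
  the segment so finely that consecutive \<open>H s\<close> agree on a ball of radius \<open>n\<close> up to a small
  translation \<open>q\<close>. By rigidity the displacement \<open>q + p s\<close> obtained from one point of the subdivision
  is the \<open>p s'\<close> of the next, so agreement on the ball of radius \<open>n\<close> propagates from \<open>H 0\<close> to
  \<open>H 1\<close>. Since \<open>p 1\<close> does not depend on \<open>n\<close>, the tilings \<open>H 1 - p 1\<close> and \<open>H 0\<close> are equal. This is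
  the discrete form of the fact that paths in a tiling space stay in one translation orbit.\<close>

lemma small_displacement:
  fixes h :: "('a::euclidean_space, 'l) tile set \<Rightarrow> ('b::euclidean_space, 'm) tile set"
  assumes \<Omega>: "tiling_space \<P> \<Omega>" and h: "\<And>T. T \<in> \<Omega> \<Longrightarrow> tiling \<P>' (h T)"
    and \<rho>: "rigid_below \<rho> \<P>'" and uc: "uniformly_patchwise \<Omega> h" and "e > 0"
  obtains \<eta> where "\<eta> > 0"
    "\<And>T u. T \<in> \<Omega> \<Longrightarrow> norm u \<le> \<eta> \<Longrightarrow> \<exists>p. norm p \<le> e \<and> h (shift T u) = shift (h T) p"
proof -
  have "\<rho> > 0" using \<rho> by (simp add: rigid_below_def)
  \<comment> \<open>Rigidity will be applied to a sum of three vectors of length at most \<open>e'\<close>.\<close>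
  define e' where "e' = min e (\<rho> / 4)"
  have e': "e' > 0" "e' \<le> e" "3 * e' < \<rho>"
    using \<open>e > 0\<close> \<open>\<rho> > 0\<close> by (auto simp: e'_def)
  obtain \<eta> where \<eta>: "\<eta> > 0"
    "\<And>S T. S \<in> \<Omega> \<Longrightarrow> T \<in> \<Omega> \<Longrightarrow> nearby \<eta> (1 / \<eta>) S T \<Longrightarrow> nearby e' 1 (h S) (h T)"
    using uc e'(1) unfolding uniformly_patchwise_def by metis
  have "\<exists>p. norm p \<le> e \<and> h (shift T u) = shift (h T) p" if T: "T \<in> \<Omega>" and u: "norm u \<le> \<eta>" for T u
  proof -
    define H where "H s = h (shift T (s *\<^sub>R u))" for s :: real
    have shift_in: "shift T x \<in> \<Omega>" for x using \<Omega> T unfolding tiling_space_def by blast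
    have tiling_H: "tiling \<P>' (H s)" for s unfolding H_def by (intro h shift_in)
    have "\<exists>p. norm p \<le> e' \<and> patch (H 0) 0 1 = patch (shift (H s) p) 0 1" if "0 \<le> s" "s \<le> 1" for s
    proof -
      have "norm (s *\<^sub>R u) \<le> \<eta>" using that u mult_mono[of s 1 "norm u" \<eta>] by simp
      then have "nearby \<eta> (1 / \<eta>) T (shift T (s *\<^sub>R u))"
        by (rule nearby_mono[OF nearby_shift_self _ order_refl])
      then have "nearby e' 1 (h T) (H s)" unfolding H_def by (intro \<eta>(2) T shift_in)
      then show ?thesis unfolding nearby_def by (simp add: H_def)
    qed
    then obtain p where p: "\<And>s. 0 \<le> s \<Longrightarrow> s \<le> 1 \<Longrightarrow> norm (p s) \<le> e'"
      "\<And>s. 0 \<le> s \<Longrightarrow> s \<le> 1 \<Longrightarrow> patch (H 0) 0 1 = patch (shift (H s) (p s)) 0 1"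
      by metis
    have p0: "patch (H 0) 0 0 = patch (shift (H s) (p s)) 0 0" if "0 \<le> s" "s \<le> 1" for s
      by (rule patch_eq_shrink[OF p(2)]) (use that in auto)
    have agree: "patch (H 0) 0 (real n) = patch (shift (H 1) (p 1)) 0 (real n)" for n
    proof -
      obtain \<delta> where \<delta>: "\<delta> > 0" "\<And>S T. S \<in> \<Omega> \<Longrightarrow> T \<in> \<Omega> \<Longrightarrow> nearby \<delta> (1 / \<delta>) S T \<Longrightarrow>
          nearby e' (real n + e') (h S) (h T)"
        using uc e'(1) unfolding uniformly_patchwise_def by metis
      obtain N :: nat where N: "norm u / \<delta> + 1 \<le> real N" using real_arch_simple by blast
      have "real N \<ge> 1" using N \<delta>(1) by (smt (verit) divide_nonneg_pos norm_ge_zero)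
      then have "N > 0" by simp
      have "norm u / \<delta> \<le> real N" using N by simp
      then have small: "norm u / real N \<le> \<delta>" using \<delta>(1) \<open>N > 0\<close> by (simp add: field_simps)
      have "patch (H 0) 0 (real n) = patch (shift (H (real i / real N)) (p (real i / real N))) 0 (real n)"
        if "i \<le> N" for i
        using that
      proof (induction i)
        case 0
        have "patch (shift (H 0) 0) 0 0 = patch (shift (H 0) (p 0)) 0 0" using p0[of 0] by simp
        moreover have "norm (0 - p 0) < \<rho>" using p(1)[of 0] e' by simp
        ultimately have "0 = p 0" by (rule rigid_belowD[OF \<rho> tiling_H])
        then show ?case by simp
      next
        case (Suc i)
        define s s' where "s = real i / real N" and "s' = real (Suc i) / real N"
        have s: "0 \<le> s" "s \<le> 1" "0 \<le> s'" "s' \<le> 1" using Suc.prems \<open>N > 0\<close> by (auto simp: s_def s'_def)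
        have diff: "s' - s = 1 / real N" by (simp add: s_def s'_def diff_divide_distrib[symmetric])
        have IH: "patch (H 0) 0 (real n) = patch (shift (H s) (p s)) 0 (real n)"
          using Suc s_def by simp
        have "norm ((s' - s) *\<^sub>R u) \<le> \<delta>" unfolding diff using small by simp
        then have "nearby \<delta> (1 / \<delta>) (shift T (s *\<^sub>R u)) (shift (shift T (s *\<^sub>R u)) ((s' - s) *\<^sub>R u))"
          by (rule nearby_mono[OF nearby_shift_self _ order_refl])
        then have "nearby \<delta> (1 / \<delta>) (shift T (s *\<^sub>R u)) (shift T (s' *\<^sub>R u))"
          by (simp add: shift_shift scaleR_diff_left)
        then have "nearby e' (real n + e') (H s) (H s')" unfolding H_def by (intro \<delta>(2) shift_in)
        then obtain q where q: "norm q \<le> e'" "patch (H s) 0 (real n + e') = patch (shift (H s') q) 0 (real n + e')"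
          unfolding nearby_def by blast
        have "patch (shift (H s) (p s)) 0 (real n) = patch (shift (shift (H s') q) (p s)) 0 (real n)"
          by (rule patch_eq_shift[OF q(2)]) (use p(1)[of s] s in simp)
        with IH have step: "patch (H 0) 0 (real n) = patch (shift (H s') (q + p s)) 0 (real n)"
          by (simp add: shift_shift)
        then have "patch (shift (H s') (q + p s)) 0 0 = patch (H 0) 0 0"
          by (rule patch_eq_shrink[OF sym]) simp
        also have "\<dots> = patch (shift (H s') (p s')) 0 0" by (rule p0) (use s in auto)
        finally have "patch (shift (H s') (q + p s)) 0 0 = patch (shift (H s') (p s')) 0 0" .
        moreover have "norm (q + p s - p s') < \<rho>"
          using q(1) p(1)[of s] p(1)[of s'] s e'(3) norm_triangle_ineq4[of "q + p s" "p s'"]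
            norm_triangle_ineq[of q "p s"] by linarith
        ultimately have "q + p s = p s'" by (rule rigid_belowD[OF \<rho> tiling_H])
        with step show ?case by (simp add: s'_def)
      qed
      from this[of N] \<open>N > 0\<close> show ?thesis by simp
    qed
    have "H 0 = shift (H 1) (p 1)"
      by (rule patch_eq_of_all_radii[OF tiling_H tiling_shift[OF tiling_H]]) (use agree in blast)
    then have "h (shift T u) = shift (h T) (- p 1)" by (simp add: H_def shift_shift)
    moreover have "norm (- p 1) \<le> e" using p(1)[of 1] e'(2) by simp
    ultimately show ?thesis by blast
  qed
  then show ?thesis using that \<eta>(1) by blast
qed

text \<open>Divide \<open>u\<close> into steps of length at most \<open>\<eta>\<close>; each of them displaces the image by at most
  \<open>e\<close>.\<close>

lemma linear_displacement:
  assumes \<Omega>: "tiling_space \<P> \<Omega>"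
    and small: "\<eta> > 0" "\<And>T u. T \<in> \<Omega> \<Longrightarrow> norm u \<le> \<eta> \<Longrightarrow> \<exists>p. norm p \<le> e \<and> h (shift T u) = shift (h T) p"
    and T: "T \<in> \<Omega>" and "e \<ge> 0"
  shows "\<exists>p. norm p \<le> e * (norm u / \<eta> + 1) \<and> h (shift T u) = shift (h T) p"
proof -
  define N where "N = nat \<lfloor>norm u / \<eta>\<rfloor> + 1"
  have "\<lfloor>norm u / \<eta>\<rfloor> \<ge> 0" using small(1) by simp
  then have "real N = real_of_int \<lfloor>norm u / \<eta>\<rfloor> + 1" by (simp add: N_def)
  then have N: "norm u / \<eta> \<le> real N" "real N \<le> norm u / \<eta> + 1" by linarith+
  have "N > 0" by (simp add: N_def)
  have "norm u / real N \<le> \<eta>" using N(1) \<open>N > 0\<close> small(1) by (simp add: field_simps)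
  then have step: "norm ((1 / real N) *\<^sub>R u) \<le> \<eta>" by simp
  have "\<exists>p. norm p \<le> e * real i \<and> h (shift T ((real i / real N) *\<^sub>R u)) = shift (h T) p" for i
  proof (induction i)
    case (Suc i)
    then obtain p where p: "norm p \<le> e * real i" "h (shift T ((real i / real N) *\<^sub>R u)) = shift (h T) p"
      by blast
    have "shift T ((real i / real N) *\<^sub>R u) \<in> \<Omega>" using \<Omega> T unfolding tiling_space_def by blast
    then obtain q where q: "norm q \<le> e"
      "h (shift (shift T ((real i / real N) *\<^sub>R u)) ((1 / real N) *\<^sub>R u)) = shift (shift (h T) p) q"
      using small(2)[OF _ step] p(2) by metis
    have "(real i / real N) *\<^sub>R u + (1 / real N) *\<^sub>R u = (real (Suc i) / real N) *\<^sub>R u"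
      by (simp add: scaleR_add_left[symmetric] add_divide_distrib add.commute)
    then have "h (shift T ((real (Suc i) / real N) *\<^sub>R u)) = shift (h T) (p + q)"
      using q(2) by (simp only: shift_shift)
    moreover have "norm (p + q) \<le> e * real (Suc i)"
      using p(1) q(1) norm_triangle_ineq[of p q] by (simp add: algebra_simps)
    ultimately show ?case by blast
  qed (auto intro: exI[of _ 0])
  then obtain p where p: "norm p \<le> e * real N" "h (shift T ((real N / real N) *\<^sub>R u)) = shift (h T) p"
    by blast
  moreover have "e * real N \<le> e * (norm u / \<eta> + 1)" using N(2) \<open>e \<ge> 0\<close> by (rule mult_left_mono)
  ultimately show ?thesis using \<open>N > 0\<close> by (intro exI[of _ p]) simp
qed

lemma displacement_bound:
  fixes h :: "('a::euclidean_space, 'l) tile set \<Rightarrow> ('b::euclidean_space, 'm) tile set"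
  assumes \<Omega>: "tiling_space \<P> \<Omega>" and h: "\<And>T. T \<in> \<Omega> \<Longrightarrow> tiling \<P>' (h T)"
    and \<rho>: "rigid_below \<rho> \<P>'" and uc: "uniformly_patchwise \<Omega> h"
  obtains M where "M \<ge> 0"
    "\<And>T u. T \<in> \<Omega> \<Longrightarrow> \<exists>p. norm p \<le> M * (norm u + 1) \<and> h (shift T u) = shift (h T) p"
proof -
  obtain \<eta> where \<eta>: "\<eta> > 0"
    "\<And>T u. T \<in> \<Omega> \<Longrightarrow> norm u \<le> \<eta> \<Longrightarrow> \<exists>p. norm p \<le> 1 \<and> h (shift T u) = shift (h T) p"
    using small_displacement[OF \<Omega> h \<rho> uc zero_less_one] by metis
  show ?thesis
  proof
    show "1 / \<eta> + 1 \<ge> 0" using \<eta>(1) by simp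
    fix T u assume "T \<in> \<Omega>"
    then obtain p where p: "norm p \<le> 1 * (norm u / \<eta> + 1)" "h (shift T u) = shift (h T) p"
      using linear_displacement[OF \<Omega> \<eta>] by (metis zero_le_one)
    have "1 * (norm u / \<eta> + 1) \<le> (1 / \<eta> + 1) * (norm u + 1)"
      using \<eta>(1) by (simp add: algebra_simps)
    with p show "\<exists>p. norm p \<le> (1 / \<eta> + 1) * (norm u + 1) \<and> h (shift T u) = shift (h T) p"
      by (meson order_trans)
  qed
qed

section \<open>Patches of the source determine patches of the image\<close>

text \<open>Let \<open>T1\<close> and \<open>T2\<close> agree on a large ball. Close to the origin, \<open>h T1\<close> agrees with \<open>h T2 - w\<close>
  for some short \<open>w\<close>. A point \<open>y\<close> of the ball of radius \<open>r\<close> corresponds, under the inverse \<open>g\<close>, to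
  a point \<open>x\<close> in a ball of radius linear in \<open>r\<close>, with \<open>h (T1 - x) = h T1 - y\<close>. Walking from \<open>0\<close> to
  \<open>x\<close> in short steps, the tilings \<open>T1\<close> and \<open>T2\<close> still agree around each intermediate point, so
  their images agree, up to a short translation, around the image points. By rigidity the translation
  between \<open>h T1\<close> and \<open>h T2\<close> cannot change from one step to the next: it is \<open>w\<close> also at \<open>y\<close>.
  Aperiodicity ensures that the walk ends at \<open>y\<close> and not at another point \<open>p\<close> with
  \<open>h T1 - p = h T1 - y\<close>.\<close>

lemma patches_determine_patches:
  fixes h :: "('a::euclidean_space, 'l) tile set \<Rightarrow> ('b::euclidean_space, 'm) tile set"
  assumes \<Omega>: "tiling_space \<P> \<Omega>" and \<Omega>': "tiling_space \<P>' \<Omega>'" "\<And>S. S \<in> \<Omega>' \<Longrightarrow> aperiodic S"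
    and h: "\<And>T. T \<in> \<Omega> \<Longrightarrow> h T \<in> \<Omega>'"
    and inv: "\<And>T. T \<in> \<Omega> \<Longrightarrow> g (h T) = T" "\<And>S. S \<in> \<Omega>' \<Longrightarrow> h (g S) = S"
    and \<rho>: "rigid_below \<rho> \<P>'" and uc: "uniformly_patchwise \<Omega> h"
    and M: "M \<ge> 0" "\<And>S u. S \<in> \<Omega>' \<Longrightarrow> \<exists>p. norm p \<le> M * (norm u + 1) \<and> g (shift S u) = shift (g S) p"
  obtains C where "C > 0" "\<And>T1 T2 r. T1 \<in> \<Omega> \<Longrightarrow> T2 \<in> \<Omega> \<Longrightarrow> r \<ge> 0 \<Longrightarrow>
      patch T1 0 (C * (r + 1)) = patch T2 0 (C * (r + 1)) \<Longrightarrow>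
      \<exists>w. norm w \<le> 1 \<and> patch (h T1) 0 r = patch (shift (h T2) w) 0 r"
proof -
  have tiling_h: "tiling \<P>' (h T)" if "T \<in> \<Omega>" for T using \<Omega>' h that unfolding tiling_space_def by blast
  have "\<rho> > 0" using \<rho> by (simp add: rigid_below_def)
  \<comment> \<open>Rigidity will be applied to a sum of four vectors of length at most \<open>e\<close>; \<open>e \<le> 1\<close> keeps
    each point of the walk in the unit ball around the next.\<close>
  define e where "e = min 1 (\<rho> / 5)"
  have e: "e > 0" "e \<le> 1" "4 * e < \<rho>" using \<open>\<rho> > 0\<close> by (auto simp: e_def)
  obtain \<delta> where \<delta>: "\<delta> > 0"
    "\<And>S T. S \<in> \<Omega> \<Longrightarrow> T \<in> \<Omega> \<Longrightarrow> nearby \<delta> (1 / \<delta>) S T \<Longrightarrow> nearby e 1 (h S) (h T)"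
    using uc e(1) unfolding uniformly_patchwise_def by metis
  obtain \<eta> where \<eta>: "\<eta> > 0"
    "\<And>T u. T \<in> \<Omega> \<Longrightarrow> norm u \<le> \<eta> \<Longrightarrow> \<exists>p. norm p \<le> e \<and> h (shift T u) = shift (h T) p"
    using small_displacement[OF \<Omega> tiling_h \<rho> uc e(1)] by metis
  define C where "C = M + 1 / \<delta>"
  have "C > 0" using M(1) \<delta>(1) unfolding C_def by (simp add: add_nonneg_pos)
  have "\<exists>w. norm w \<le> 1 \<and> patch (h T1) 0 r = patch (shift (h T2) w) 0 r"
    if T: "T1 \<in> \<Omega>" "T2 \<in> \<Omega>" and r: "r \<ge> 0" and eq: "patch T1 0 (C * (r + 1)) = patch T2 0 (C * (r + 1))"
    for T1 T2 r
  proof -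
    have "1 / \<delta> * (r + 1) \<ge> 1 / \<delta>" using r \<delta>(1) by (simp add: field_simps)
    then have C_ge: "M * (r + 1) + 1 / \<delta> \<le> C * (r + 1)" by (simp add: C_def algebra_simps)
    have shift_in: "shift T1 x \<in> \<Omega>" "shift T2 x \<in> \<Omega>" for x using \<Omega> T unfolding tiling_space_def by auto
    have close: "\<exists>v. norm v \<le> e \<and> patch (h (shift T1 x)) 0 1 = patch (shift (h (shift T2 x)) v) 0 1"
      if "norm x \<le> M * (r + 1)" for x
    proof -
      have "patch (shift T1 x) 0 (1 / \<delta>) = patch (shift T2 x) 0 (1 / \<delta>)"
        by (rule patch_eq_shift[OF eq]) (use C_ge that in linarith)
      then have "nearby \<delta> (1 / \<delta>) (shift T1 x) (shift T2 x)"
        unfolding nearby_def using \<delta>(1) by (intro exI[of _ 0]) simp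
      then show ?thesis using \<delta>(2)[OF shift_in] unfolding nearby_def by blast
    qed
    have "norm (0::'a) \<le> M * (r + 1)" using M(1) r by simp
    then obtain w where w: "norm w \<le> e" "patch (h T1) 0 1 = patch (shift (h T2) w) 0 1"
      using close[of 0] by auto
    have "patch (h T1) y 0 = patch (shift (h T2) w) y 0" if y: "norm y \<le> r" for y
    proof -
      obtain x where x: "norm x \<le> M * (norm y + 1)" "g (shift (h T1) y) = shift (g (h T1)) x"
        using M(2) h T(1) by blast
      have "shift (h T1) y \<in> \<Omega>'" using h[OF T(1)] \<Omega>'(1) unfolding tiling_space_def by blast
      then have hx: "h (shift T1 x) = shift (h T1) y" using x(2) inv T(1) by metis
      have "M * (norm y + 1) \<le> M * (r + 1)" using y M(1) by (simp add: mult_left_mono)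
      then have x_le: "norm x \<le> M * (r + 1)" using x(1) by linarith
      obtain N :: nat where N: "norm x / \<eta> + 1 \<le> real N" using real_arch_simple by blast
      have "real N \<ge> 1" using N \<eta>(1) by (smt (verit) divide_nonneg_pos norm_ge_zero)
      then have "N > 0" by simp
      have "norm x / \<eta> \<le> real N" using N by simp
      then have "norm x / real N \<le> \<eta>" using \<eta>(1) \<open>N > 0\<close> by (simp add: field_simps)
      then have step: "norm ((1 / real N) *\<^sub>R x) \<le> \<eta>" by simp
      \<comment> \<open>Here \<open>p\<close> is the image of the point reached on the segment, and \<open>v\<close> the short translation
        that matches the two images around it.\<close>
      have "\<exists>p v. h (shift T1 ((real i / real N) *\<^sub>R x)) = shift (h T1) p
          \<and> patch (h T1) p 1 = patch (shift (h T2) w) p 1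
          \<and> norm v \<le> e \<and> h (shift T2 ((real i / real N) *\<^sub>R x)) = shift (h T2) (w + p - v)"
        if "i \<le> N" for i
        using that
      proof (induction i)
        case 0
        then show ?case using w by (intro exI[of _ 0] exI[of _ w]) simp
      next
        case (Suc i)
        define a b where "a = (real i / real N) *\<^sub>R x" and "b = (real (Suc i) / real N) *\<^sub>R x"
        have ab: "a + (1 / real N) *\<^sub>R x = b"
          unfolding a_def b_def by (simp add: scaleR_add_left[symmetric] add_divide_distrib add.commute)
        obtain p v where IH: "h (shift T1 a) = shift (h T1) p"
          "patch (h T1) p 1 = patch (shift (h T2) w) p 1"
          "norm v \<le> e" "h (shift T2 a) = shift (h T2) (w + p - v)"
          using Suc unfolding a_def by auto
        obtain d1 where d1: "norm d1 \<le> e" "h (shift T1 b) = shift (h T1) (p + d1)"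
          using \<eta>(2)[OF shift_in(1)[of a] step] IH(1) by (auto simp: shift_shift ab)
        obtain d2 where d2: "norm d2 \<le> e" "h (shift T2 b) = shift (h T2) (w + p - v + d2)"
          using \<eta>(2)[OF shift_in(2)[of a] step] IH(4) by (auto simp: shift_shift ab)
        have "norm b = real (Suc i) / real N * norm x" by (simp add: b_def)
        also have "\<dots> \<le> 1 * norm x" using Suc.prems \<open>N > 0\<close> by (intro mult_right_mono) auto
        finally have "norm b \<le> M * (r + 1)" using x_le by simp
        then obtain v' where v': "norm v' \<le> e"
          "patch (h (shift T1 b)) 0 1 = patch (shift (h (shift T2 b)) v') 0 1"
          using close by blast
        \<comment> \<open>The translation between the images that is valid around the next point \<open>p + d1\<close>.\<close>
        define w' where "w' = w - v + d2 + v' - d1"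
        have "patch (shift (h T1) (p + d1)) 0 1 = patch (shift (shift (h T2) w') (p + d1)) 0 1"
          using v'(2) unfolding d1(2) d2(2) by (simp add: shift_shift w'_def algebra_simps)
        then have new: "patch (h T1) (p + d1) 1 = patch (shift (h T2) w') (p + d1) 1"
          by (simp add: patch_shift_eq_iff)
        have "patch (h T1) p 0 = patch (shift (h T2) w) p 0"
          by (rule patch_mono[OF IH(2)]) simp
        moreover have "patch (h T1) p 0 = patch (shift (h T2) w') p 0"
          by (rule patch_mono[OF new]) (use d1(1) e(2) in \<open>simp add: dist_norm\<close>)
        ultimately have "patch (shift (h T2) w) p 0 = patch (shift (h T2) w') p 0" by simp
        moreover have "norm (w - w') < \<rho>"
        proof -
          have "w - w' = (v - d2) + (d1 - v')" by (simp add: w'_def)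
          then have "norm (w - w') \<le> norm (v - d2) + norm (d1 - v')"
            by (simp only: norm_triangle_ineq)
          then show ?thesis
            using norm_triangle_ineq4[of v d2] norm_triangle_ineq4[of d1 v'] IH(3) d1(1) d2(1) v'(1) e(3)
            by linarith
        qed
        ultimately have "w = w'" by (rule rigid_belowD[OF \<rho> tiling_h[OF T(2)]])
        then have "w + p - v + d2 = w + (p + d1) - v'"
          by (simp add: w'_def algebra_simps)
        with new d1(2) d2(2) v'(1) \<open>w = w'\<close> show ?case unfolding b_def by metis
      qed
      from this[of N] obtain p where p: "h (shift T1 x) = shift (h T1) p"
        "patch (h T1) p 1 = patch (shift (h T2) w) p 1"
        using \<open>N > 0\<close> by auto
      have "p = y" using p(1) hx aperiodic_shift_inject \<Omega>'(2) h[OF T(1)] by metis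
      show ?thesis by (rule patch_mono[OF p(2)]) (simp add: \<open>p = y\<close>)
    qed
    then have "patch (h T1) 0 r = patch (shift (h T2) w) 0 r" by (rule patch_eqI) simp
    then show ?thesis using w(1) e(2) by (intro exI[of _ w]) simp
  qed
  then show ?thesis using that \<open>C > 0\<close> by blast
qed

section \<open>Linear repetitivity without transversals\<close>

text \<open>Linear repetitivity for all tilings of the space in place of those of a transversal. Writing
  \<open>r + 1\<close> for \<open>r\<close> allows all radii \<open>r \<ge> 0\<close> and absorbs additive constants.\<close>

definition linearly_recurrent where
  "linearly_recurrent \<Omega> \<longleftrightarrow> (\<exists>C\<ge>0. \<forall>r\<ge>0. \<forall>T\<in>\<Omega>. \<forall>T0\<in>\<Omega>.
     \<exists>x. norm x \<le> C * (r + 1) \<and> patch (shift T x) 0 r = patch T0 0 r)"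

text \<open>To find \<open>S0\<close> on the ball of radius \<open>r\<close> in \<open>S\<close>, find \<open>g S0\<close> on a ball of radius linear in \<open>r\<close>
  in \<open>g S\<close>. Applying \<open>h\<close> turns the vector found into one of comparable length, and agreement is
  preserved up to a translation by a short \<open>w\<close>, which is added to that vector.\<close>

lemma linearly_recurrent_transfer:
  assumes \<Omega>: "tiling_space \<P> \<Omega>"
    and g: "\<And>S. S \<in> \<Omega>' \<Longrightarrow> g S \<in> \<Omega>" and inv: "\<And>S. S \<in> \<Omega>' \<Longrightarrow> h (g S) = S"
    and M: "M \<ge> 0" "\<And>T u. T \<in> \<Omega> \<Longrightarrow> \<exists>p. norm p \<le> M * (norm u + 1) \<and> h (shift T u) = shift (h T) p"
    and C: "C > 0" "\<And>T1 T2 r. T1 \<in> \<Omega> \<Longrightarrow> T2 \<in> \<Omega> \<Longrightarrow> r \<ge> 0 \<Longrightarrow>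
      patch T1 0 (C * (r + 1)) = patch T2 0 (C * (r + 1)) \<Longrightarrow>
      \<exists>w. norm w \<le> 1 \<and> patch (h T1) 0 r = patch (shift (h T2) w) 0 r"
    and rec: "linearly_recurrent \<Omega>"
  shows "linearly_recurrent \<Omega>'"
proof -
  obtain L where L: "L \<ge> 0" "\<And>r T T0. r \<ge> 0 \<Longrightarrow> T \<in> \<Omega> \<Longrightarrow> T0 \<in> \<Omega> \<Longrightarrow>
      \<exists>x. norm x \<le> L * (r + 1) \<and> patch (shift T x) 0 r = patch T0 0 r"
    using rec unfolding linearly_recurrent_def by metis
  define L' where "L' = M * (L * (C + 1) + 1) + 1"
  have "L' \<ge> 0" using L M(1) C(1) by (simp add: L'_def)
  moreover have "\<exists>y. norm y \<le> L' * (r + 1) \<and> patch (shift S y) 0 r = patch S0 0 r"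
    if r: "r \<ge> 0" and S: "S \<in> \<Omega>'" "S0 \<in> \<Omega>'" for r S S0
  proof -
    have "C * (r + 1) \<ge> 0" using C(1) r by simp
    then obtain x where x: "norm x \<le> L * (C * (r + 1) + 1)"
      "patch (shift (g S) x) 0 (C * (r + 1)) = patch (g S0) 0 (C * (r + 1))"
      using L(2) g S by blast
    have "shift (g S) x \<in> \<Omega>" using \<Omega> g[OF S(1)] unfolding tiling_space_def by blast
    then obtain w where w: "norm w \<le> 1" "patch S0 0 r = patch (shift (h (shift (g S) x)) w) 0 r"
      using C(2)[OF g[OF S(2)] _ r x(2)[symmetric]] inv S by metis
    obtain p where p: "norm p \<le> M * (norm x + 1)" "h (shift (g S) x) = shift S p"
      using M(2)[OF g[OF S(1)]] inv S by metis
    have "C * (r + 1) + 1 \<le> (C + 1) * (r + 1)" using r by (simp add: algebra_simps)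
    then have "L * (C * (r + 1) + 1) \<le> L * ((C + 1) * (r + 1))" using L(1) by (rule mult_left_mono)
    then have "norm x + 1 \<le> (L * (C + 1) + 1) * (r + 1)"
      using x(1) r by (simp add: algebra_simps)
    then have "M * (norm x + 1) \<le> M * ((L * (C + 1) + 1) * (r + 1))" using M(1) by (rule mult_left_mono)
    then have "norm (p + w) \<le> L' * (r + 1)"
      using p(1) w(1) r norm_triangle_ineq[of p w] by (simp add: L'_def algebra_simps)
    moreover have "patch (shift S (p + w)) 0 r = patch S0 0 r"
      using w(2) p(2) by (simp add: shift_shift)
    ultimately show ?thesis by blast
  qed
  ultimately show ?thesis unfolding linearly_recurrent_def by blast
qed

lemma repetitivity_function_le:
  assumes "R > 0" "\<And>T T0. T \<in> \<Xi> \<Longrightarrow> T0 \<in> \<Xi> \<Longrightarrow> \<exists>x\<in>cball 0 R. patch (shift T x) 0 r = patch T0 0 r"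
  shows "repetitivity_function \<Xi> r \<le> ereal R"
  unfolding repetitivity_function_def by (rule Inf_lower) (use assms in blast)

lemma repetitivity_function_lessD:
  assumes "repetitivity_function \<Xi> r < ereal R" "T \<in> \<Xi>" "T0 \<in> \<Xi>"
  shows "\<exists>x. norm x \<le> R \<and> patch (shift T x) 0 r = patch T0 0 r"
proof -
  obtain R' where R': "ereal R' < ereal R" "\<forall>T\<in>\<Xi>. \<forall>T0\<in>\<Xi>. \<exists>x\<in>cball 0 R'. patch (shift T x) 0 r = patch T0 0 r"
    using assms(1) unfolding repetitivity_function_def Inf_less_iff by blast
  then obtain x where "x \<in> cball 0 R'" "patch (shift T x) 0 r = patch T0 0 r" using assms by blast
  then show ?thesis using R'(1) by (intro exI[of _ x]) simp
qed

text \<open>A pointing rule is obtained by marking the occurrences of the tiles of a fixed tiling \<open>T0\<close> at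
  the origin. Recurrence makes the marked points relatively dense, rigidity makes them uniformly
  discrete, and then recurrence for all tilings restricts to the transversal.\<close>

lemma linearly_repetitive_if_recurrent:
  assumes \<Omega>: "tiling_space \<P> \<Omega>" and ne: "T0 \<in> \<Omega>" and \<rho>: "rigid_below \<rho> \<P>"
    and rec: "linearly_recurrent \<Omega>"
  shows "linearly_repetitive \<Omega>"
proof -
  obtain L where L: "L \<ge> 0" "\<And>r T T0. r \<ge> 0 \<Longrightarrow> T \<in> \<Omega> \<Longrightarrow> T0 \<in> \<Omega> \<Longrightarrow>
      \<exists>x. norm x \<le> L * (r + 1) \<and> patch (shift T x) 0 r = patch T0 0 r"
    using rec unfolding linearly_recurrent_def by metis
  have shift_in: "shift T x \<in> \<Omega>" if "T \<in> \<Omega>" for T x using \<Omega> that unfolding tiling_space_def by blast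
  define D where "D T = {x. patch (shift T x) 0 0 = patch T0 0 0}" for T
  have "uniform_discrete (D T)" if T: "T \<in> \<Omega>" for T
    unfolding uniform_discrete_def
  proof (intro exI[of _ \<rho>] conjI ballI impI)
    show "\<rho> > 0" using \<rho> by (simp add: rigid_below_def)
    fix x y assume "x \<in> D T" "y \<in> D T" and less: "dist x y < \<rho>"
    then have "patch (shift T x) 0 0 = patch (shift T y) 0 0" by (simp add: D_def)
    then show "x = y"
      using rigid_belowD[OF \<rho>] \<Omega> T less unfolding tiling_space_def dist_norm by blast
  qed
  moreover have "relatively_dense (D T)" if T: "T \<in> \<Omega>" for T
    unfolding relatively_dense_def
  proof (intro exI[of _ "L + 1"] conjI allI)
    show "L + 1 > 0" using L(1) by simp
    fix z
    obtain x where x: "norm x \<le> L * (0 + 1)" "patch (shift (shift T z) x) 0 0 = patch T0 0 0"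
      using L(2)[OF order_refl shift_in[OF T] ne] by blast
    then have "z + x \<in> D T" by (simp add: D_def shift_shift)
    moreover have "z + x \<in> cball z (L + 1)" using x(1) by (simp add: dist_norm)
    ultimately show "D T \<inter> cball z (L + 1) \<noteq> {}" by blast
  qed
  moreover have "D (shift T x) = (\<lambda>y. y - x) ` D T" for T x
  proof -
    have "y \<in> D (shift T x) \<longleftrightarrow> y + x \<in> D T" for y by (simp add: D_def shift_shift add.commute)
    then show ?thesis by (force simp: image_iff algebra_simps)
  qed
  moreover have "D T \<inter> cball 0 1 = D T' \<inter> cball 0 1" if "patch T 0 1 = patch T' 0 1" for T T'
  proof -
    have "patch (shift T x) 0 0 = patch (shift T' x) 0 0" if "norm x \<le> 1" for x
      by (rule patch_eq_shift[OF \<open>patch T 0 1 = patch T' 0 1\<close>]) (use that in simp)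
    then show ?thesis by (auto simp: D_def)
  qed
  ultimately have "local_pointing_rule \<Omega> D"
    unfolding local_pointing_rule_def Delaunay_def by (meson zero_less_one)
  moreover have "\<forall>\<^sub>F r in at_top. repetitivity_function (canonical_transversal \<Omega> D) r \<le> ereal ((2 * L + 1) * r)"
    using eventually_ge_at_top[of "1::real"]
  proof eventually_elim
    case (elim r)
    show ?case
    proof (rule repetitivity_function_le)
      show "(2 * L + 1) * r > 0" using L(1) elim by simp
      fix T T1 assume "T \<in> canonical_transversal \<Omega> D" "T1 \<in> canonical_transversal \<Omega> D"
      then have "T \<in> \<Omega>" "T1 \<in> \<Omega>" by (auto simp: canonical_transversal_def)
      then obtain x where x: "norm x \<le> L * (r + 1)" "patch (shift T x) 0 r = patch T1 0 r"
        using L(2) elim by (metis order_trans zero_le_one)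
      have "L * (r + 1) \<le> L * (2 * r)" using L(1) elim by (intro mult_left_mono) auto
      then have "norm x \<le> (2 * L + 1) * r" using x(1) elim by (simp add: algebra_simps)
      with x(2) show "\<exists>x\<in>cball 0 ((2 * L + 1) * r). patch (shift T x) 0 r = patch T1 0 r" by auto
    qed
  qed
  ultimately show ?thesis unfolding linearly_repetitive_def by blast
qed

text \<open>Covariance under translation transports the locality of a pointing rule from the origin to
  every other point.\<close>

lemma pointing_rule_agree:
  assumes \<Omega>: "tiling_space \<P> \<Omega>" and D: "local_pointing_rule \<Omega> D"
  obtains R where "\<And>S T r. S \<in> \<Omega> \<Longrightarrow> T \<in> \<Omega> \<Longrightarrow> patch S 0 (r + R) = patch T 0 (r + R) \<Longrightarrow>
    D S \<inter> cball 0 r = D T \<inter> cball 0 r"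
proof -
  have cov: "\<And>T x. T \<in> \<Omega> \<Longrightarrow> D (shift T x) = (\<lambda>y. y - x) ` D T"
    using D unfolding local_pointing_rule_def by blast
  have "\<exists>\<rho>>0. \<exists>R>0. \<forall>S\<in>\<Omega>. \<forall>T\<in>\<Omega>. patch S 0 R = patch T 0 R \<longrightarrow> D S \<inter> cball 0 \<rho> = D T \<inter> cball 0 \<rho>"
    using D unfolding local_pointing_rule_def by (elim conjE)
  then obtain \<rho> R where R: "\<rho> > 0"
    "\<And>S T. S \<in> \<Omega> \<Longrightarrow> T \<in> \<Omega> \<Longrightarrow> patch S 0 R = patch T 0 R \<Longrightarrow> D S \<inter> cball 0 \<rho> = D T \<inter> cball 0 \<rho>"
    by metis
  have mem: "y \<in> D T \<longleftrightarrow> 0 \<in> D (shift T y)" if "T \<in> \<Omega>" for T y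
    unfolding cov[OF that] by (auto simp: image_iff)
  show ?thesis
  proof
    fix S T r assume S: "S \<in> \<Omega>" "T \<in> \<Omega>" and eq: "patch S 0 (r + R) = patch T 0 (r + R)"
    have "y \<in> D S \<longleftrightarrow> y \<in> D T" if "norm y \<le> r" for y
    proof -
      have "patch (shift S y) 0 R = patch (shift T y) 0 R"
        by (rule patch_eq_shift[OF eq]) (use that in simp)
      moreover have "shift S y \<in> \<Omega>" "shift T y \<in> \<Omega>" using \<Omega> S unfolding tiling_space_def by auto
      ultimately have "D (shift S y) \<inter> cball 0 \<rho> = D (shift T y) \<inter> cball 0 \<rho>" by (intro R(2))
      moreover have "0 \<in> cball (0::'a) \<rho>" using R(1) by simp
      ultimately show ?thesis unfolding mem[OF S(1)] mem[OF S(2)] by blast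
    qed
    then show "D S \<inter> cball 0 r = D T \<inter> cball 0 r" by auto
  qed
qed

text \<open>Each \<open>D S\<close> is relatively dense with a constant of its own. A constant for \<open>T\<close> works throughout
  the hull, because each \<open>S\<close> agrees with a translate of \<open>T\<close> on any given ball and pointing rules
  are local.\<close>

lemma pointing_rule_uniformly_dense:
  assumes T: "tiling \<P> T" and D: "local_pointing_rule (tiling_hull \<P> T) D"
  obtains R where "\<And>S. S \<in> tiling_hull \<P> T \<Longrightarrow> \<exists>y\<in>D S. norm y \<le> R"
proof -
  have space: "tiling_space \<P> (tiling_hull \<P> T)" by (rule tiling_space_hull[OF T])
  have T_in: "shift T x \<in> tiling_hull \<P> T" for x
    using tiling_hull_iff[OF T] tiling_shift[OF T] by blast
  then have T_in0: "T \<in> tiling_hull \<P> T" by (metis shift_0)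
  obtain R0 where R0: "\<And>x. D T \<inter> cball x R0 \<noteq> {}"
    using D T_in0 unfolding local_pointing_rule_def Delaunay_def relatively_dense_def by blast
  have cov: "\<And>x. D (shift T x) = (\<lambda>y. y - x) ` D T"
    using D T_in0 unfolding local_pointing_rule_def by blast
  obtain R where R: "\<And>S S' r. S \<in> tiling_hull \<P> T \<Longrightarrow> S' \<in> tiling_hull \<P> T \<Longrightarrow>
      patch S 0 (r + R) = patch S' 0 (r + R) \<Longrightarrow> D S \<inter> cball 0 r = D S' \<inter> cball 0 r"
    using pointing_rule_agree[OF space D] by metis
  show ?thesis
  proof
    fix S assume S: "S \<in> tiling_hull \<P> T"
    then obtain x where "patch S 0 (R0 + R) = patch (shift T x) 0 (R0 + R)"
      using tiling_hull_iff[OF T] by blast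
    then have eq: "D S \<inter> cball 0 R0 = D (shift T x) \<inter> cball 0 R0" by (intro R S T_in)
    obtain y where "y \<in> D T" "y \<in> cball x R0" using R0 by blast
    then have "y - x \<in> D (shift T x) \<inter> cball 0 R0"
      unfolding cov by (auto simp: dist_norm norm_minus_commute)
    then show "\<exists>y\<in>D S. norm y \<le> R0" unfolding eq[symmetric] by auto
  qed
qed

text \<open>Two arbitrary tilings are brought into the transversal by translations of length at most \<open>Q\<close>,
  and these are undone after an occurrence of the larger patch of radius \<open>r + Q\<close> has been found.\<close>

lemma linearly_recurrent_if_repetitive:
  assumes T: "tiling \<P> T" and rep: "linearly_repetitive (tiling_hull \<P> T)"
  shows "linearly_recurrent (tiling_hull \<P> T)"
proof -
  let ?\<Omega> = "tiling_hull \<P> T"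
  have space: "tiling_space \<P> ?\<Omega>" by (rule tiling_space_hull[OF T])
  have shift_in: "shift S x \<in> ?\<Omega>" if "S \<in> ?\<Omega>" for S x using space that unfolding tiling_space_def by blast
  obtain D C0 where D: "local_pointing_rule ?\<Omega> D"
    and ev: "\<forall>\<^sub>F r in at_top. repetitivity_function (canonical_transversal ?\<Omega> D) r \<le> ereal (C0 * r)"
    using rep unfolding linearly_repetitive_def by blast
  obtain r0 where r0: "\<And>r. r \<ge> r0 \<Longrightarrow>
      repetitivity_function (canonical_transversal ?\<Omega> D) r \<le> ereal (C0 * r)"
    using ev unfolding eventually_at_top_linorder by blast
  obtain Q0 where Q0: "\<And>S. S \<in> ?\<Omega> \<Longrightarrow> \<exists>y\<in>D S. norm y \<le> Q0"
    using pointing_rule_uniformly_dense[OF T D] by metis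
  \<comment> \<open>Making \<open>Q\<close> exceed \<open>r0\<close> as well puts every radius \<open>r + Q\<close> into the range of the linear bound.\<close>
  define Q where "Q = \<bar>Q0\<bar> + \<bar>r0\<bar>"
  define C where "C = \<bar>C0\<bar>"
  have "Q \<ge> 0" "C \<ge> 0" "r0 \<le> Q" "Q0 \<le> Q" by (auto simp: Q_def C_def)
  have pointed: "\<exists>y. norm y \<le> Q \<and> shift S y \<in> canonical_transversal ?\<Omega> D" if S: "S \<in> ?\<Omega>" for S
  proof -
    obtain y where y: "y \<in> D S" "norm y \<le> Q0" using Q0 S by blast
    have "D (shift S y) = (\<lambda>z. z - y) ` D S" using D S unfolding local_pointing_rule_def by blast
    then have "0 \<in> D (shift S y)" using y(1) by force
    then show ?thesis using y(2) \<open>Q0 \<le> Q\<close> shift_in[OF S]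
      by (intro exI[of _ y]) (auto simp: canonical_transversal_def)
  qed
  define L where "L = 2 * Q + C * (Q + 1) + 1"
  have "L \<ge> 0" using \<open>Q \<ge> 0\<close> \<open>C \<ge> 0\<close> by (simp add: L_def)
  moreover have "\<exists>x. norm x \<le> L * (r + 1) \<and> patch (shift S x) 0 r = patch S0 0 r"
    if r: "r \<ge> 0" and S: "S \<in> ?\<Omega>" "S0 \<in> ?\<Omega>" for r S S0
  proof -
    obtain y y0 where y: "norm y \<le> Q" "shift S y \<in> canonical_transversal ?\<Omega> D"
      "norm y0 \<le> Q" "shift S0 y0 \<in> canonical_transversal ?\<Omega> D"
      using pointed S by meson
    have "repetitivity_function (canonical_transversal ?\<Omega> D) (r + Q) \<le> ereal (C0 * (r + Q))"
      using r \<open>r0 \<le> Q\<close> by (intro r0) simp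
    also have "\<dots> < ereal (C0 * (r + Q) + 1)" by simp
    finally obtain x where x: "norm x \<le> C0 * (r + Q) + 1"
      "patch (shift (shift S y) x) 0 (r + Q) = patch (shift S0 y0) 0 (r + Q)"
      using repetitivity_function_lessD y by blast
    have "patch (shift (shift (shift S y) x) (- y0)) 0 r = patch (shift (shift S0 y0) (- y0)) 0 r"
      by (rule patch_eq_shift[OF x(2)]) (use y in simp)
    then have "patch (shift S (y + x - y0)) 0 r = patch S0 0 r" by (simp add: shift_shift)
    moreover have "norm (y + x - y0) \<le> L * (r + 1)"
    proof -
      have "norm (y + x - y0) \<le> norm y + norm x + norm y0"
        using norm_triangle_ineq4[of "y + x" y0] norm_triangle_ineq[of y x] by linarith
      moreover have "C0 * (r + Q) \<le> C * ((Q + 1) * (r + 1))"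
      proof -
        have "C0 * (r + Q) \<le> C * (r + Q)" unfolding C_def using r \<open>Q \<ge> 0\<close> by (intro mult_right_mono) auto
        also have "\<dots> \<le> C * ((Q + 1) * (r + 1))"
          using r \<open>Q \<ge> 0\<close> \<open>C \<ge> 0\<close> by (intro mult_left_mono) (simp_all add: algebra_simps)
        finally show ?thesis .
      qed
      moreover have "2 * Q \<le> 2 * Q * (r + 1)" using r \<open>Q \<ge> 0\<close> by (simp add: algebra_simps)
      ultimately show ?thesis using y x(1) r by (simp add: L_def algebra_simps)
    qed
    ultimately show ?thesis by blast
  qed
  ultimately show ?thesis unfolding linearly_recurrent_def by blast
qed

section \<open>Invariance under homeomorphism\<close>

lemma linearly_repetitive_transfer:
  fixes \<P> :: "('a::euclidean_space, 'l) tile set set" and \<P>' :: "('b::euclidean_space, 'm) tile set set"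
  assumes \<Omega>: "aperiodic_repetitive_FLC_space \<P> \<Omega>" and \<Omega>': "aperiodic_repetitive_FLC_space \<P>' \<Omega>'"
    and hom: "homeomorphic_map (subtopology (tiling_topology \<P>) \<Omega>) (subtopology (tiling_topology \<P>') \<Omega>') h"
    and rep: "linearly_repetitive \<Omega>"
  shows "linearly_repetitive \<Omega>'"
proof -
  obtain T where P: "prototile_collection \<P>" and T: "tiling \<P> T" "finite_local_complexity T"
    and T_hull: "\<Omega> = tiling_hull \<P> T"
    using \<Omega> unfolding aperiodic_repetitive_FLC_space_def by blast
  obtain T' where P': "prototile_collection \<P>'"
    and T': "tiling \<P>' T'" "aperiodic T'" "repetitive T'" "finite_local_complexity T'"
    and T'_hull: "\<Omega>' = tiling_hull \<P>' T'"
    using \<Omega>' unfolding aperiodic_repetitive_FLC_space_def by blast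
  have space: "tiling_space \<P> \<Omega>" "tiling_space \<P>' \<Omega>'"
    unfolding T_hull T'_hull by (intro tiling_space_hull T T')+
  have compact: "compactin (tiling_topology \<P>) \<Omega>" "compactin (tiling_topology \<P>') \<Omega>'"
    unfolding T_hull T'_hull by (intro hull_compactin P P' T T')+
  have aper: "aperiodic S" if "S \<in> \<Omega>'" for S
    using hull_aperiodic[OF T'(1,3,2)] that unfolding T'_hull by blast
  obtain g where maps: "homeomorphic_maps (subtopology (tiling_topology \<P>) \<Omega>)
      (subtopology (tiling_topology \<P>') \<Omega>') h g"
    using hom unfolding homeomorphic_map_maps by blast
  have top: "topspace (subtopology (tiling_topology \<P>) \<Omega>) = \<Omega>"
    "topspace (subtopology (tiling_topology \<P>') \<Omega>') = \<Omega>'"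
    by (intro topspace_subtopology_subset compactin_subset_topspace compact)+
  have cont: "continuous_map (subtopology (tiling_topology \<P>) \<Omega>) (subtopology (tiling_topology \<P>') \<Omega>') h"
    "continuous_map (subtopology (tiling_topology \<P>') \<Omega>') (subtopology (tiling_topology \<P>) \<Omega>) g"
    and inv: "\<And>S. S \<in> \<Omega> \<Longrightarrow> g (h S) = S" "\<And>S. S \<in> \<Omega>' \<Longrightarrow> h (g S) = S"
    using maps unfolding homeomorphic_maps_def top by simp_all
  have in_h: "h S \<in> \<Omega>'" if "S \<in> \<Omega>" for S
    using continuous_map_image_subset_topspace[OF cont(1)] that unfolding top by blast
  have in_g: "g S \<in> \<Omega>" if "S \<in> \<Omega>'" for S
    using continuous_map_image_subset_topspace[OF cont(2)] that unfolding top by blast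
  have uc: "uniformly_patchwise \<Omega> h" "uniformly_patchwise \<Omega>' g"
    by (rule continuous_map_uniformly_patchwise[OF compact(1) cont(1)])
      (rule continuous_map_uniformly_patchwise[OF compact(2) cont(2)])
  obtain \<rho> where \<rho>: "rigid_below \<rho> \<P>" using ex_rigid_below[OF P] .
  obtain \<rho>' where \<rho>': "rigid_below \<rho>' \<P>'" using ex_rigid_below[OF P'] .
  obtain M where M: "M \<ge> 0"
    "\<And>S u. S \<in> \<Omega> \<Longrightarrow> \<exists>p. norm p \<le> M * (norm u + 1) \<and> h (shift S u) = shift (h S) p"
    using displacement_bound[OF space(1) _ \<rho>' uc(1)] in_h space(2) unfolding tiling_space_def by metis
  obtain M' where M': "M' \<ge> 0"
    "\<And>S u. S \<in> \<Omega>' \<Longrightarrow> \<exists>p. norm p \<le> M' * (norm u + 1) \<and> g (shift S u) = shift (g S) p"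
    using displacement_bound[OF space(2) _ \<rho> uc(2)] in_g space(1) unfolding tiling_space_def by metis
  obtain C where C: "C > 0" "\<And>T1 T2 r. T1 \<in> \<Omega> \<Longrightarrow> T2 \<in> \<Omega> \<Longrightarrow> r \<ge> 0 \<Longrightarrow>
      patch T1 0 (C * (r + 1)) = patch T2 0 (C * (r + 1)) \<Longrightarrow>
      \<exists>w. norm w \<le> 1 \<and> patch (h T1) 0 r = patch (shift (h T2) w) 0 r"
    using patches_determine_patches[OF space aper in_h inv \<rho>' uc(1) M'] by blast
  have rec: "linearly_recurrent \<Omega>"
    using linearly_recurrent_if_repetitive[OF T(1)] rep unfolding T_hull by blast
  have "linearly_recurrent \<Omega>'"
    by (rule linearly_recurrent_transfer[where h = h and g = g and M = M and C = C])
      (fact space in_g inv M C rec)+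
  moreover have "T' \<in> \<Omega>'"
    unfolding T'_hull tiling_hull_iff[OF T'(1)] using T'(1) shift_0 by metis
  ultimately show ?thesis using linearly_repetitive_if_recurrent[OF space(2) _ \<rho>'] by blast
qed

theorem corollary3p6:
  fixes \<P> :: "(real ^ 'd::finite, 'l) tile set set" and \<Omega> :: "(real ^ 'd, 'l) tile set set"
    and \<P>' :: "(real ^ 'd, 'm) tile set set" and \<Omega>' :: "(real ^ 'd, 'm) tile set set"
    and h :: "(real ^ 'd, 'l) tile set \<Rightarrow> (real ^ 'd, 'm) tile set"
  assumes "aperiodic_repetitive_FLC_space \<P> \<Omega>"
    and "aperiodic_repetitive_FLC_space \<P>' \<Omega>'"
    and "homeomorphic_map (subtopology (tiling_topology \<P>) \<Omega>) (subtopology (tiling_topology \<P>') \<Omega>') h"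
  shows "linearly_repetitive \<Omega> \<longleftrightarrow> linearly_repetitive \<Omega>'"
proof -
  obtain g where "homeomorphic_maps (subtopology (tiling_topology \<P>) \<Omega>)
      (subtopology (tiling_topology \<P>') \<Omega>') h g"
    using assms(3) unfolding homeomorphic_map_maps by blast
  then have "homeomorphic_map (subtopology (tiling_topology \<P>') \<Omega>') (subtopology (tiling_topology \<P>) \<Omega>) g"
    using homeomorphic_map_maps homeomorphic_maps_sym by blast
  then show ?thesis
    using linearly_repetitive_transfer[OF assms] linearly_repetitive_transfer[OF assms(2,1)] by blast
qed

end
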